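(* As $n\to\infty$, we have $|\mathrm{VHC}(S_n)|\sim n!/c^{n+1}$, where $c\approx 1.32874$ is the smallest positive real root of \[1-z\,{}_1F_2\left(\frac{1}{2};\frac{3}{2},2;-z^2\right).\]
   Context: ${}_1F_2$ is the generalized hypergeometric function ${}_1F_2(a;b_1,b_2;w)=\sum_{k\ge0}\frac{(a)_k}{(b_1)_k(b_2)_k}\frac{w^k}{k!}$, where $(a)_k=a(a+1)\cdots(a+k-1)$. $S_n$ is the set of permutations $\pi=\pi_1\cdots\pi_n$ of $\{1,\dots,n\}$; a descent of $\pi$ is an index $i\in\{1,\dots,n-1\}$ with $\pi_i>\pi_{i+1}$; the plot of $\pi$ is the set of points $(i,\pi_i)$. A hook of $\pi$ with southwest endpoint $(i,\pi_i)$ and northeast endpoint $(j,\pi_j)$, where $i<j$ and $\pi_i<\pi_j$, is the union of the vertical segment from $(i,\pi_i)$ to $(i,\pi_j)$ and the horizontal segment from $(i,\pi_j)$ to $(j,\pi_j)$. If $d_1<\cdots<d_k$ are the descents of $\pi$, a valid hook configuration of $\pi$ is a tuple $\mathcal H=(H_1,\ldots,H_k)$ of hooks of $\pi$ such that: (1) the southwest endpoint of $H_i$ is $(d_i,\pi_{d_i})$ for each $i$; (2) no point of the plot lies directly above a hook (i.e. if $H_m$ has northeast endpoint $(j_m,\pi_{j_m})$, then $\pi_x<\pi_{j_m}$ for all $d_m<x<j_m$); (3) no two hooks intersect or overlap unless the northeast endpoint of one is the southwest endpoint of the other. $\mathrm{VHC}(\pi)$ is the set of valid hook configurations of $\pi$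 (a single empty configuration if $\pi$ has no descents). A valid hook configuration includes its underlying permutation as part of its identity, and $\mathrm{VHC}(S_n)=\bigcup_{\pi\in S_n}\mathrm{VHC}(\pi)$ (a disjoint union). *)

theory Defs
  imports "HOL-Analysis.Analysis" "HOL-Library.Landau_Symbols"
begin

definition hypergeo_1F2 :: "'a \<Rightarrow> 'a \<Rightarrow> 'a \<Rightarrow> 'a \<Rightarrow> 'a::{real_normed_field,banach}" where
  "hypergeo_1F2 a b1 b2 w =
     (\<Sum>k. pochhammer a k / (pochhammer b1 k * pochhammer b2 k) * (w ^ k / fact k))"

text \<open>A permutation of \<open>{1..n}\<close> is a function \<open>p\<close> with \<open>p permutes {1..n}\<close>;
  its plot consists of the points \<open>(i, p i)\<close>, viewed in the real plane.\<close>

definition descents :: "nat \<Rightarrow> (nat \<Rightarrow> nat) \<Rightarrow> nat set" where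
  "descents n p = {i \<in> {1..<n}. p i > p (i + 1)}"

text \<open>A hook is encoded by the pair \<open>(i, j)\<close> of the abscissae of its southwest and its
  northeast endpoint. These determine the hook as a subset of the plane, \<open>hook_points\<close>,
  and are determined by it.\<close>

definition is_hook :: "nat \<Rightarrow> (nat \<Rightarrow> nat) \<Rightarrow> nat \<times> nat \<Rightarrow> bool" where
  "is_hook n p = (\<lambda>(i, j). i \<in> {1..n} \<and> j \<in> {1..n} \<and> i < j \<and> p i < p j)"

definition hook_points :: "(nat \<Rightarrow> nat) \<Rightarrow> nat \<times> nat \<Rightarrow> (real \<times> real) set" where
  "hook_points p = (\<lambda>(i, j).
     closed_segment (real i, real (p i)) (real i, real (p j)) \<union>
     closed_segment (real i, real (p j)) (real j, real (p j)))"

text \<open>The tuple of hooks is a list, aligned with the increasing list of descents. In the last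
  condition, equality of abscissae means equality of the endpoints.\<close>

definition VHC :: "nat \<Rightarrow> (nat \<Rightarrow> nat) \<Rightarrow> (nat \<times> nat) list set" where
  "VHC n p = {H.
     (\<forall>h \<in> set H. is_hook n p h) \<and>
     map fst H = sorted_list_of_set (descents n p) \<and>
     (\<forall>(d, j) \<in> set H. \<forall>x. d < x \<and> x < j \<longrightarrow> p x < p j) \<and>
     (\<forall>h \<in> set H. \<forall>h' \<in> set H. h \<noteq> h' \<longrightarrow>
        hook_points p h \<inter> hook_points p h' = {} \<or> snd h = fst h' \<or> snd h' = fst h)}"

definition VHC_S :: "nat \<Rightarrow> ((nat \<Rightarrow> nat) \<times> (nat \<times> nat) list) set" where
  "VHC_S n = (SIGMA p : {p. p permutes {1..n}}. VHC n p)"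

definition smallest_pos_root :: "(real \<Rightarrow> real) \<Rightarrow> real \<Rightarrow> bool" where
  "smallest_pos_root f c \<longleftrightarrow> c > 0 \<and> f c = 0 \<and> (\<forall>z. z > 0 \<and> f z = 0 \<longrightarrow> c \<le> z)"

end

theory Submission
  imports Defs "HOL-Combinatorics.Multiset_Permutations"
begin

text \<open>
The entry \<open>n\<close> of a permutation cannot start a hook, so a permutation with a valid hook
configuration ends with its largest entry (\<open>arcs_last_max\<close>). Removing it, one either keeps a valid
hook configuration of the remaining entries, or a hook ends at it; this hook then starts at a descent
and separates the remaining entries into two consecutive segments, each with a configuration of its
own (\<open>card_arcs_Suc\<close>). If the cut were arbitrary, the number of pairs would be a plain
binomial convolution. But the cut has to be at a descent, so one subtracts the pairs
that are cut at an ascent. For these one needs to know the number \<open>R\<^sub>n\<^sub>,\<^sub>i\<close> of ways to cut a permutation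
of \<open>n\<close> entries at \<open>i\<close> ascents and to choose a configuration on each segment; the same
decomposition applies to them (\<open>cut_count_snoc\<close>). Thus the exponential generating
functions \<open>r\<^sub>i(z) = (\<Sum>n\<ge>1. R\<^sub>n\<^sub>,\<^sub>i z\<^sup>n / n!)\<close> satisfy the system

  \<open>r\<^sub>i' = [i = 0] + (1 + r\<^sub>0) r\<^sub>i + r\<^sub>i\<^sub>-\<^sub>1 - r\<^sub>i\<^sub>+\<^sub>1\<close>,  \<open>r\<^sub>i(0) = 0\<close>,  \<open>r\<^sub>-\<^sub>1 = 0\<close>,

in which \<open>1 + r\<^sub>0 = (\<Sum>n. |VHC(S\<^sub>n)| z\<^sup>n / n!)\<close>. A solution is unique, being given by a recurrence in \<open>n\<close>.
The substitution \<open>r\<^sub>i = X\<^sub>i / M\<close> with \<open>1 + r\<^sub>0 = - M' / M\<close> linearizes the system. With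
\<open>W\<^sub>i(z) = (i + 1) J\<^bsub>i+1\<^esub>(2 z) / z\<close>, for which \<open>W\<^sub>i' = W\<^sub>i\<^sub>-\<^sub>1 - W\<^sub>i\<^sub>+\<^sub>1\<close> (where \<open>W\<^sub>-\<^sub>1 = 0\<close>), the
choice \<open>M' = - W\<^sub>0\<close>, \<open>M(0) = 1\<close>, \<open>X\<^sub>i' = W\<^sub>i - W\<^sub>i\<^sub>+\<^sub>1\<close>, \<open>X\<^sub>i(0) = 0\<close> does it
(\<open>fps_deriv_cut_fps\<close>), and \<open>M\<close> is the function of the theorem, by comparison of coefficients. Hence

  \<open>(\<Sum>n. |VHC(S\<^sub>n)| z\<^sup>n / n!) = - M'(z) / M(z)\<close>.

The sign of a truncated series locates a root \<open>c\<close> of \<open>M\<close>. In the factorization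
\<open>M(z) = (1 - z / c) Q(z)\<close>, the coefficients of \<open>Q - 1\<close> are so small that \<open>|Q - 1| \<le> 9/10\<close> on the disc of
radius \<open>7/5 > c\<close> (\<open>cofactor_tail_small\<close>). So \<open>c\<close> is the smallest positive root, and in
\<open>- M' / M = 1 / (c - z) - Q' / Q\<close> the coefficients of the second term are of order \<open>(5/7)\<^sup>n\<close>, negligible
against those of the first, \<open>1 / c\<^sup>n\<^sup>+\<^sup>1\<close>. As the second term is controlled by a recurrence for
its coefficients (\<open>fps_inverse_coeff_bound\<close>), no complex function theory enters.
\<close>

section \<open>Hook configurations as noncrossing arcs\<close>

lemma hook_points_iff:
  assumes "i < j" "p i < p j"
  shows "(x, y) \<in> hook_points p (i, j) \<longleftrightarrow>
    x = real i \<and> real (p i) \<le> y \<and> y \<le> real (p j) \<or>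
    y = real (p j) \<and> real i \<le> x \<and> x \<le> real j"
proof -
  have vert: "(x, y) \<in> closed_segment (a, b) (a, c) \<longleftrightarrow> x = a \<and> b \<le> y \<and> y \<le> c"
    if "b < c" for a b c :: real
  proof
    assume "(x, y) \<in> closed_segment (a, b) (a, c)"
    then obtain u where u: "0 \<le> u" "u \<le> 1" "x = (1 - u) * a + u * a" "y = (1 - u) * b + u * c"
      by (auto simp: in_segment)
    have "y \<in> closed_segment b c" unfolding in_segment using u by auto
    moreover have "x = a" using u(3) by (simp add: algebra_simps)
    ultimately show "x = a \<and> b \<le> y \<and> y \<le> c"
      using that by (simp add: closed_segment_eq_real_ivl)
  next
    assume *: "x = a \<and> b \<le> y \<and> y \<le> c"
    hence "y \<in> closed_segment b c" using that by (simp add: closed_segment_eq_real_ivl)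
    then obtain u where "0 \<le> u" "u \<le> 1" "y = (1 - u) * b + u * c"
      by (auto simp: in_segment)
    thus "(x, y) \<in> closed_segment (a, b) (a, c)" using *
      by (auto simp: in_segment algebra_simps intro!: exI[of _ u])
  qed
  have hor: "(x, y) \<in> closed_segment (b, a) (c, a) \<longleftrightarrow> y = a \<and> b \<le> x \<and> x \<le> c"
    if "b < c" for a b c :: real
  proof
    assume "(x, y) \<in> closed_segment (b, a) (c, a)"
    then obtain u where u: "0 \<le> u" "u \<le> 1" "y = (1 - u) * a + u * a" "x = (1 - u) * b + u * c"
      by (auto simp: in_segment)
    have "x \<in> closed_segment b c" unfolding in_segment using u by auto
    moreover have "y = a" using u(3) by (simp add: algebra_simps)
    ultimately show "y = a \<and> b \<le> x \<and> x \<le> c"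
      using that by (simp add: closed_segment_eq_real_ivl)
  next
    assume *: "y = a \<and> b \<le> x \<and> x \<le> c"
    hence "x \<in> closed_segment b c" using that by (simp add: closed_segment_eq_real_ivl)
    then obtain u where "0 \<le> u" "u \<le> 1" "x = (1 - u) * b + u * c"
      by (auto simp: in_segment)
    thus "(x, y) \<in> closed_segment (b, a) (c, a)" using *
      by (auto simp: in_segment algebra_simps intro!: exI[of _ u])
  qed
  show ?thesis
    using assms by (simp add: hook_points_def vert hor)
qed

text \<open>Given that no plot point lies above a hook, the geometric condition is pure combinatorics
of abscissae. Let the second hook start under the horizontal segment of the first, \<open>d < d' < j\<close>. If
\<open>j' \<ge> j\<close>, then it reaches at least the height \<open>p j\<close>, since \<open>(j, p j)\<close> is not above it, and its vertical
segment meets that horizontal segment in \<open>(d', p j)\<close>. If \<open>j' < j\<close>, it stays strictly below the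
horizontal segment and to the right of the vertical one.\<close>

lemma hooks_cross_iff:
  assumes "d < d'" "d < j" "d' < j'" and below: "\<forall>x\<in>{d..<j}. p x < p j" "\<forall>x\<in>{d'..<j'}. p x < p j'"
  shows "(hook_points p (d, j) \<inter> hook_points p (d', j') = {} \<or> j = d' \<or> j' = d)
    \<longleftrightarrow> (d' < j \<longrightarrow> j' < j)"
proof -
  have pj: "p d < p j" "p d' < p j'" using assms by auto
  note iff = hook_points_iff[OF \<open>d < j\<close> pj(1)] hook_points_iff[OF \<open>d' < j'\<close> pj(2)]
  show ?thesis
  proof (cases "d' < j")
    case False
    have "hook_points p (d, j) \<inter> hook_points p (d', j') = {}" if "j < d'"
    proof -
      have False if "a \<in> hook_points p (d, j)" "a \<in> hook_points p (d', j')" for a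
        using that iff \<open>j < d'\<close> \<open>d < j\<close> \<open>d' < j'\<close> by (cases a) auto
      thus ?thesis by blast
    qed
    thus ?thesis using False by auto
  next
    case True
    have pd': "p d' < p j" using True assms by auto
    show ?thesis
    proof (cases "j' < j")
      case j': True
      hence "p j' < p j" using assms by auto
      hence False if "a \<in> hook_points p (d, j)" "a \<in> hook_points p (d', j')" for a
        using that iff \<open>d < d'\<close> pj by (cases a) auto
      thus ?thesis using j' by blast
    next
      case j': False
      have "p j \<le> p j'"
        using j' True below(2) by (cases "j = j'") (auto intro: less_imp_le)
      hence "(real d', real (p j)) \<in> hook_points p (d, j) \<inter> hook_points p (d', j')"
        using iff True \<open>d < d'\<close> pd' by auto
      thus ?thesis using j' True assms by auto
    qed
  qed
qed

text \<open>The combinatorial form of a valid hook configuration, on an arbitrary interval of positions: a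
noncrossing set of arcs, one leaving each descent. Positions are not renumbered when an interval
is cut in two, so that arc sets on adjacent intervals can simply be united.\<close>

definition arcs :: "(nat \<Rightarrow> nat) \<Rightarrow> nat \<Rightarrow> nat \<Rightarrow> (nat \<times> nat) set set" where
  "arcs p l u = {E. E \<subseteq> {l..<u} \<times> {l..<u} \<and> fst ` E = {i. l \<le> i \<and> Suc i < u \<and> p (Suc i) < p i} \<and>
     (\<forall>d j. (d, j) \<in> E \<longrightarrow> d < j \<and> (\<forall>x\<in>{d..<j}. p x < p j)) \<and>
     (\<forall>d j d' j'. (d, j) \<in> E \<longrightarrow> (d', j') \<in> E \<longrightarrow>
        (d = d' \<longrightarrow> j = j') \<and> (d < d' \<longrightarrow> d' < j \<longrightarrow> j' < j))}"

lemma arcsD: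
  assumes "E \<in> arcs p l u"
  shows "E \<subseteq> {l..<u} \<times> {l..<u}"
    and "fst ` E = {i. l \<le> i \<and> Suc i < u \<and> p (Suc i) < p i}"
    and "(d, j) \<in> E \<Longrightarrow> d < j"
    and "(d, j) \<in> E \<Longrightarrow> \<forall>x\<in>{d..<j}. p x < p j"
    and "(d, j) \<in> E \<Longrightarrow> (d, j') \<in> E \<Longrightarrow> j = j'"
    and "(d, j) \<in> E \<Longrightarrow> (d', j') \<in> E \<Longrightarrow> d < d' \<Longrightarrow> d' < j \<Longrightarrow> j' < j"
  using assms by (simp_all add: arcs_def)

lemma VHC_imp_arcs:
  assumes "H \<in> VHC n p"
  shows "set H \<in> arcs p 1 (Suc n)"
proof -
  have fin: "finite (descents n p)" by (simp add: descents_def)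
  have hk: "is_hook n p h" if "h \<in> set H" for h using assms that by (auto simp: VHC_def)
  have fs: "map fst H = sorted_list_of_set (descents n p)" using assms by (auto simp: VHC_def)
  have dist: "distinct (map fst H)" using fs by simp
  have bel: "p x < p j" if "(d, j) \<in> set H" "d \<le> x" "x < j" for d j x
  proof (cases "d = x")
    case True thus ?thesis using hk[OF that(1)] by (auto simp: is_hook_def)
  next
    case False thus ?thesis using that assms unfolding VHC_def by fastforce
  qed
  have lt: "d < j" "d \<in> {1..n}" "j \<in> {1..n}" if "(d, j) \<in> set H" for d j
    using hk[OF that] by (auto simp: is_hook_def)
  have disj: "hook_points p h \<inter> hook_points p h' = {} \<or> snd h = fst h' \<or> snd h' = fst h"
    if "h \<in> set H" "h' \<in> set H" "h \<noteq> h'" for h h'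
    using assms that unfolding VHC_def by blast
  have 1: "set H \<subseteq> {1..<Suc n} \<times> {1..<Suc n}" using lt by force
  have 2: "fst ` set H = {i. 1 \<le> i \<and> Suc i < Suc n \<and> p (Suc i) < p i}"
  proof -
    have "fst ` set H = set (map fst H)" by simp
    also have "\<dots> = descents n p" unfolding fs using fin by simp
    finally show ?thesis by (auto simp: descents_def)
  qed
  have 3: "d = d' \<longrightarrow> j = j'" if "(d, j) \<in> set H" "(d', j') \<in> set H" for d j d' j'
    using dist that by (metis eq_key_imp_eq_value)
  have 4: "j' < j" if "(d, j) \<in> set H" "(d', j') \<in> set H" "d < d'" "d' < j" for d j d' j'
    using hooks_cross_iff[of d d' j j' p] disj[OF that(1,2)] that lt bel by auto
  show ?thesis unfolding arcs_def using 1 2 3 4 lt bel by auto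
qed

lemma arcs_imp_VHC:
  assumes "E \<in> arcs p 1 (Suc n)"
  shows "\<exists>H\<in>VHC n p. set H = E"
proof -
  note sub = arcsD(1)[OF assms] and fs = arcsD(2)[OF assms] and lt = arcsD(3)[OF assms]
    and bel = arcsD(4)[OF assms] and sv = arcsD(5)[OF assms] and nest = arcsD(6)[OF assms]
  have fE: "fst ` E = descents n p" using fs by (auto simp: descents_def)
  have fin: "finite (descents n p)" by (simp add: descents_def)
  define J where "J d = (SOME j. (d, j) \<in> E)" for d
  have J: "(d, J d) \<in> E" if "d \<in> descents n p" for d
    using that fE[symmetric] unfolding J_def by (auto intro: someI)
  define H where "H = map (\<lambda>d. (d, J d)) (sorted_list_of_set (descents n p))"
  have setH: "set H = E"
  proof
    show "set H \<subseteq> E" using J fin by (auto simp: H_def)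
    show "E \<subseteq> set H"
    proof
      fix e assume e: "e \<in> E"
      obtain d j where dj: "e = (d, j)" by (cases e)
      have d: "d \<in> descents n p" using e fE dj by force
      have "j = J d" using sv J[OF d] e dj by blast
      thus "e \<in> set H" using d fin by (auto simp: H_def dj)
    qed
  qed
  have cross: "hook_points p h \<inter> hook_points p h' = {} \<or> snd h = fst h' \<or> snd h' = fst h"
    if hh: "h \<in> E" "h' \<in> E" "fst h < fst h'" for h h'
  proof -
    obtain d j d' j' where eq: "h = (d, j)" "h' = (d', j')" by (cases h, cases h')
    show ?thesis
      using hooks_cross_iff[of d d' j j' p] hh lt bel nest[of d j d' j'] unfolding eq by auto
  qed
  have "hook_points p h \<inter> hook_points p h' = {} \<or> snd h = fst h' \<or> snd h' = fst h"
    if hh: "h \<in> E" "h' \<in> E" "h \<noteq> h'" for h h'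
  proof -
    have "fst h \<noteq> fst h'" using sv hh by (metis prod.collapse)
    thus ?thesis using cross[of h h'] cross[of h' h] hh by (metis Int_commute linorder_neqE_nat)
  qed
  moreover have "is_hook n p h" if "h \<in> E" for h
    using that sub lt bel by (cases h) (fastforce simp: is_hook_def)
  moreover have "map fst H = sorted_list_of_set (descents n p)"
    by (simp add: H_def comp_def)
  ultimately have "H \<in> VHC n p"
    unfolding VHC_def using setH bel by auto
  thus ?thesis using setH by blast
qed

text \<open>The list of hooks is sorted by abscissa of the starting point, and these abscissae are
distinct; hence the list carries no more information than its set.\<close>

lemma bij_betw_VHC_arcs: "bij_betw set (VHC n p) (arcs p 1 (Suc n))"
proof (intro bij_betwI')
  fix H H' assume H: "H \<in> VHC n p" "H' \<in> VHC n p"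
  have m: "map fst H = map fst H'" "distinct (map fst H)" using H by (auto simp: VHC_def)
  show "(set H = set H') = (H = H')"
  proof
    assume s: "set H = set H'"
    show "H = H'"
    proof (rule nth_equalityI)
      show len: "length H = length H'" using m(1) by (rule map_eq_imp_length_eq)
      fix i assume i: "i < length H"
      have "fst (H ! i) = fst (H' ! i)"
        using arg_cong[OF m(1), of "\<lambda>xs. xs ! i"] i len by simp
      moreover have "H ! i \<in> set H" using i by (rule nth_mem)
      moreover have "H' ! i \<in> set H" unfolding s using i len by simp
      moreover have "inj_on fst (set H)" using m(2) by (simp add: distinct_map)
      ultimately show "H ! i = H' ! i" by (metis inj_onD)
    qed
  qed simp
next
  fix H assume "H \<in> VHC n p" thus "set H \<in> arcs p 1 (Suc n)" by (rule VHC_imp_arcs)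
next
  fix E assume "E \<in> arcs p 1 (Suc n)" thus "\<exists>H\<in>VHC n p. E = set H" using arcs_imp_VHC by blast
qed

section \<open>Decomposition at the last entry\<close>

lemma arcsI:
  assumes "E \<subseteq> {l..<u} \<times> {l..<u}"
    and "fst ` E = {i. l \<le> i \<and> Suc i < u \<and> p (Suc i) < p i}"
    and "\<And>d j. (d, j) \<in> E \<Longrightarrow> d < j"
    and "\<And>d j x. (d, j) \<in> E \<Longrightarrow> d \<le> x \<Longrightarrow> x < j \<Longrightarrow> p x < p j"
    and "\<And>d j j'. (d, j) \<in> E \<Longrightarrow> (d, j') \<in> E \<Longrightarrow> j = j'"
    and "\<And>d j d' j'. (d, j) \<in> E \<Longrightarrow> (d', j') \<in> E \<Longrightarrow> d < d' \<Longrightarrow> d' < j \<Longrightarrow> j' < j"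
  shows "E \<in> arcs p l u"
proof -
  have "(d = d' \<longrightarrow> j = j') \<and> (d < d' \<longrightarrow> d' < j \<longrightarrow> j' < j)"
    if "(d, j) \<in> E" "(d', j') \<in> E" for d j d' j'
    using that assms(5,6) by blast
  thus ?thesis using assms(1,2,3,4) by (simp add: arcs_def)
qed

lemma arcs_range:
  assumes "E \<in> arcs p l u" "(a, b) \<in> E"
  shows "l \<le> a \<and> a < b \<and> b < u"
proof -
  have "(a, b) \<in> {l..<u} \<times> {l..<u}" using arcsD(1)[OF assms(1)] assms(2) by (rule subsetD)
  thus ?thesis using arcsD(3)[OF assms] by simp
qed

lemma arcs_subset:
  assumes E: "E \<in> arcs p l u" and F: "F \<subseteq> E" "F \<subseteq> {l'..<u'} \<times> {l'..<u'}"
    "fst ` F = {i. l' \<le> i \<and> Suc i < u' \<and> p (Suc i) < p i}"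
  shows "F \<in> arcs p l' u'"
proof (rule arcsI)
  note mem = subsetD[OF F(1)]
  show "d < j" if "(d, j) \<in> F" for d j
    by (rule arcsD(3)[OF E mem[OF that]])
  show "p x < p j" if "(d, j) \<in> F" "d \<le> x" "x < j" for d j x
    using arcsD(4)[OF E mem[OF that(1)]] that(2,3) by simp
  show "j = j'" if "(d, j) \<in> F" "(d, j') \<in> F" for d j j'
    by (rule arcsD(5)[OF E mem[OF that(1)] mem[OF that(2)]])
  show "j' < j" if "(d, j) \<in> F" "(d', j') \<in> F" "d < d'" "d' < j" for d j d' j'
    by (rule arcsD(6)[OF E mem[OF that(1)] mem[OF that(2)] that(3,4)])
qed (use F in simp_all)

lemma finite_arcs [simp]: "finite (arcs p l u)"
  by (rule finite_subset[of _ "Pow ({l..<u} \<times> {l..<u})"]) (auto dest: arcsD(1))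

lemma arcs_singleton: "arcs p l (Suc l) = {{}}"
proof -
  have "E = {}" if "E \<in> arcs p l (Suc l)" for E
    using arcsD(2)[OF that] by auto
  moreover have "{} \<in> arcs p l (Suc l)" by (rule arcsI) auto
  ultimately show ?thesis by blast
qed

text \<open>The largest entry cannot start a hook, so it is not at a descent; hence it comes last.\<close>

lemma arcs_last_max:
  assumes "E \<in> arcs p l (Suc u)" "inj_on p {l..<Suc u}" "x \<in> {l..<u}"
  shows "p x < p u"
proof (rule ccontr)
  assume neg: "\<not> p x < p u"
  have fin: "finite (p ` {l..<Suc u})" by simp
  obtain m where m: "m \<in> {l..<Suc u}" "\<And>y. y \<in> {l..<Suc u} \<Longrightarrow> p y \<le> p m"
  proof -
    have "Max (p ` {l..<Suc u}) \<in> p ` {l..<Suc u}" using assms(3) by (intro Max_in) auto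
    then obtain m where "m \<in> {l..<Suc u}" "p m = Max (p ` {l..<Suc u})" by auto
    thus ?thesis using that fin by (metis Max_ge imageI)
  qed
  have "p x \<noteq> p u" using inj_onD[OF assms(2), of x u] assms(3) by auto
  hence "m \<noteq> u" using neg m(2)[of x] assms(3) by auto
  hence mu: "m < u" using m(1) by auto
  have "p (Suc m) \<noteq> p m" using inj_onD[OF assms(2), of "Suc m" m] m(1) mu by auto
  moreover have "p (Suc m) \<le> p m" using m mu by auto
  ultimately have "m \<in> fst ` E" using arcsD(2)[OF assms(1)] m(1) mu by auto
  then obtain j where j: "(m, j) \<in> E" by auto
  hence "p m < p j" using arcsD(3,4)[OF assms(1) j] by auto
  moreover have "j \<in> {l..<Suc u}" using j arcsD(1)[OF assms(1)] by auto
  ultimately show False using m(2) by fastforce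
qed

text \<open>Let the last entry be the largest. Either no arc ends there, and the configuration
lives on the shorter interval; or exactly one arc \<open>(d, u)\<close> does, and since all other arcs are
nested or disjoint, it separates the rest into a configuration on the positions up to \<open>d\<close> and one
on the positions strictly between \<open>d\<close> and \<open>u\<close>.\<close>

context
  fixes p :: "nat \<Rightarrow> nat" and l u :: nat
  assumes lu: "l < u" and last_max: "\<And>x. x \<in> {l..<u} \<Longrightarrow> p x < p u"
begin

lemma descents_drop_last:
  "{i. l \<le> i \<and> Suc i < Suc u \<and> p (Suc i) < p i} = {i. l \<le> i \<and> Suc i < u \<and> p (Suc i) < p i}"
  using last_max by (auto simp: less_Suc_eq) (metis less_not_sym)

lemma arcs_extend: "arcs p l u = {E \<in> arcs p l (Suc u). u \<notin> snd ` E}"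
proof (intro equalityI subsetI CollectI conjI)
  fix E assume E: "E \<in> arcs p l u"
  note D = arcsD[OF E]
  show "u \<notin> snd ` E" using D(1) by auto
  show "E \<in> arcs p l (Suc u)"
  proof (rule arcs_subset[OF E])
    show "E \<subseteq> {l..<Suc u} \<times> {l..<Suc u}" using D(1) by force
    show "fst ` E = {i. l \<le> i \<and> Suc i < Suc u \<and> p (Suc i) < p i}"
      unfolding descents_drop_last by (rule D(2))
  qed simp
next
  fix E assume "E \<in> {E \<in> arcs p l (Suc u). u \<notin> snd ` E}"
  hence E: "E \<in> arcs p l (Suc u)" and un: "u \<notin> snd ` E" by auto
  note D = arcsD[OF E]
  show "E \<in> arcs p l u"
  proof (rule arcs_subset[OF E])
    have "d < u \<and> j < u \<and> l \<le> d \<and> l \<le> j" if "(d, j) \<in> E" for d j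
    proof -
      have "j \<noteq> u" using un that by force
      thus ?thesis using D(1,3) that by fastforce
    qed
    thus "E \<subseteq> {l..<u} \<times> {l..<u}" by auto
    show "fst ` E = {i. l \<le> i \<and> Suc i < u \<and> p (Suc i) < p i}"
      unfolding descents_drop_last[symmetric] by (rule D(2))
  qed simp
qed

lemma arcs_join:
  assumes d: "l \<le> d" "Suc d < u" "p (Suc d) < p d"
    and E1: "E1 \<in> arcs p l (Suc d)" and E2: "E2 \<in> arcs p (Suc d) u"
  shows "insert (d, u) (E1 \<union> E2) \<in> arcs p l (Suc u)"
proof -
  note D1 = arcsD[OF E1] and D2 = arcsD[OF E2]
  let ?E = "insert (d, u) (E1 \<union> E2)"
  have place: "(a, b) \<notin> E1 \<and> (a, b) \<notin> E2 \<and> a = d \<and> b = u \<or>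
      (a, b) \<in> E1 \<and> (a, b) \<notin> E2 \<and> l \<le> a \<and> a < b \<and> b \<le> d \<or>
      (a, b) \<notin> E1 \<and> (a, b) \<in> E2 \<and> d < a \<and> a < b \<and> b < u" if "(a, b) \<in> ?E" for a b
    using that arcs_range[OF E1, of a b] arcs_range[OF E2, of a b] d by auto
  show ?thesis
  proof (rule arcsI)
    show "?E \<subseteq> {l..<Suc u} \<times> {l..<Suc u}"
    proof
      fix e assume "e \<in> ?E"
      thus "e \<in> {l..<Suc u} \<times> {l..<Suc u}" using place[of "fst e" "snd e"] d by (cases e) auto
    qed
    have "fst ` ?E = insert d (fst ` E1 \<union> fst ` E2)" by auto
    also have "\<dots> = {i. l \<le> i \<and> Suc i < u \<and> p (Suc i) < p i}"
      unfolding D1(2) D2(2) using d by (auto simp: not_less_eq less_Suc_eq)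
    finally show "fst ` ?E = {i. l \<le> i \<and> Suc i < Suc u \<and> p (Suc i) < p i}"
      unfolding descents_drop_last .
  next
    fix a b assume "(a, b) \<in> ?E"
    thus "a < b" using place[of a b] d by auto
  next
    fix a b x assume *: "(a, b) \<in> ?E" "a \<le> x" "x < b"
    thus "p x < p b" using place[of a b] D1(4)[of a b] D2(4)[of a b] last_max[of x] d by auto
  next
    fix a b b' assume "(a, b) \<in> ?E" "(a, b') \<in> ?E"
    thus "b = b'" using place[of a b] place[of a b'] D1(5)[of a b b'] D2(5)[of a b b'] by auto
  next
    fix a b a' b' assume "(a, b) \<in> ?E" "(a', b') \<in> ?E" "a < a'" "a' < b"
    thus "b' < b" using place[of a b] place[of a' b'] D1(6)[of a b a' b'] D2(6)[of a b a' b'] by auto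
  qed
qed

lemma arcs_split:
  assumes E: "E \<in> arcs p l (Suc u)" and du: "(d, u) \<in> E"
  shows "l \<le> d" "Suc d < u" "p (Suc d) < p d"
    and "{e \<in> E. snd e \<le> d} \<in> arcs p l (Suc d)" "{e \<in> E. d < fst e} \<in> arcs p (Suc d) u"
    and "E = insert (d, u) ({e \<in> E. snd e \<le> d} \<union> {e \<in> E. d < fst e})"
proof -
  note D = arcsD[OF E]
  have "d \<in> fst ` E" using du by force
  hence "d \<in> {i. l \<le> i \<and> Suc i < u \<and> p (Suc i) < p i}"
    unfolding D(2) descents_drop_last .
  thus d: "l \<le> d" "Suc d < u" "p (Suc d) < p d" by auto
  have tri: "(a, b) = (d, u) \<or> (l \<le> a \<and> a < b \<and> b \<le> d) \<or> (d < a \<and> a < b \<and> b < u)"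
    if "(a, b) \<in> E" for a b
  proof -
    have *: "a < b" "l \<le> a" "b \<le> u" using arcs_range[OF E that] by auto
    consider "a < d" | "a = d" | "d < a" by linarith
    thus ?thesis
    proof cases
      case 1
      have "\<not> d < b" using D(6)[OF that du 1] *(3) by auto
      thus ?thesis using * by auto
    next
      case 2 thus ?thesis using D(5)[OF that, of u] du by auto
    next
      case 3
      hence "b < u" using D(6)[OF du that] * by auto
      thus ?thesis using 3 * by auto
    qed
  qed
  show "E = insert (d, u) ({e \<in> E. snd e \<le> d} \<union> {e \<in> E. d < fst e})"
  proof (intro equalityI subsetI)
    fix e assume "e \<in> E"
    thus "e \<in> insert (d, u) ({e \<in> E. snd e \<le> d} \<union> {e \<in> E. d < fst e})"
      using tri[of "fst e" "snd e"] by (cases e) auto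
  qed (use du in auto)
  have img: "i \<in> fst ` E \<longleftrightarrow> l \<le> i \<and> Suc i < u \<and> p (Suc i) < p i" for i
    unfolding D(2) descents_drop_last by simp
  show "{e \<in> E. snd e \<le> d} \<in> arcs p l (Suc d)"
  proof (rule arcs_subset[OF E])
    show "{e \<in> E. snd e \<le> d} \<subseteq> {l..<Suc d} \<times> {l..<Suc d}"
    proof
      fix e assume "e \<in> {e \<in> E. snd e \<le> d}"
      thus "e \<in> {l..<Suc d} \<times> {l..<Suc d}"
        using tri[of "fst e" "snd e"] d by (cases e) auto
    qed
    have "i \<in> fst ` {e \<in> E. snd e \<le> d} \<longleftrightarrow> i \<in> fst ` E \<and> i < d" for i
    proof
      assume "i \<in> fst ` {e \<in> E. snd e \<le> d}"
      then obtain j where "(i, j) \<in> E" "j \<le> d" by auto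
      thus "i \<in> fst ` E \<and> i < d" using tri[of i j] d by (auto intro!: image_eqI[of _ _ "(i, j)"])
    next
      assume "i \<in> fst ` E \<and> i < d"
      then obtain j where "(i, j) \<in> E" "i < d" by auto
      moreover from this have "j \<le> d" using tri[of i j] by auto
      ultimately show "i \<in> fst ` {e \<in> E. snd e \<le> d}" by (auto intro!: image_eqI[of _ _ "(i, j)"])
    qed
    thus "fst ` {e \<in> E. snd e \<le> d} = {i. l \<le> i \<and> Suc i < Suc d \<and> p (Suc i) < p i}"
      unfolding img using d by auto
  qed blast
  show "{e \<in> E. d < fst e} \<in> arcs p (Suc d) u"
  proof (rule arcs_subset[OF E])
    show "{e \<in> E. d < fst e} \<subseteq> {Suc d..<u} \<times> {Suc d..<u}"
    proof
      fix e assume "e \<in> {e \<in> E. d < fst e}"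
      thus "e \<in> {Suc d..<u} \<times> {Suc d..<u}"
        using tri[of "fst e" "snd e"] d by (cases e) auto
    qed
    have "i \<in> fst ` {e \<in> E. d < fst e} \<longleftrightarrow> i \<in> fst ` E \<and> d < i" for i
      by force
    thus "fst ` {e \<in> E. d < fst e} = {i. Suc d \<le> i \<and> Suc i < u \<and> p (Suc i) < p i}"
      unfolding img using d by auto
  qed blast
qed

lemma card_arcs_ending_at_last:
  assumes d: "l \<le> d" "Suc d < u" "p (Suc d) < p d"
  shows "card {E \<in> arcs p l (Suc u). (d, u) \<in> E} = card (arcs p l (Suc d)) * card (arcs p (Suc d) u)"
proof -
  let ?S = "{E \<in> arcs p l (Suc u). (d, u) \<in> E}"
  define f where "f = (\<lambda>(E1, E2). insert (d, u) (E1 \<union> E2))"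
  define g where "g E = ({e \<in> E. snd e \<le> d}, {e \<in> E. d < fst e})" for E :: "(nat \<times> nat) set"
  have "bij_betw f (arcs p l (Suc d) \<times> arcs p (Suc d) u) ?S"
  proof (rule bij_betw_byWitness[where f' = g])
    show "\<forall>a\<in>arcs p l (Suc d) \<times> arcs p (Suc d) u. g (f a) = a"
    proof clarify
      fix E1 E2 assume E: "E1 \<in> arcs p l (Suc d)" "E2 \<in> arcs p (Suc d) u"
      have r1: "a < b \<and> b \<le> d" if "(a, b) \<in> E1" for a b
        using arcs_range[OF E(1) that] by auto
      have r2: "Suc d \<le> a \<and> a < b \<and> b < u" if "(a, b) \<in> E2" for a b
        using arcs_range[OF E(2) that] by auto
      have "e \<in> insert (d, u) (E1 \<union> E2) \<and> snd e \<le> d \<longleftrightarrow> e \<in> E1" for e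
        using r1[of "fst e" "snd e"] r2[of "fst e" "snd e"] d by (cases e) auto
      hence "{e \<in> insert (d, u) (E1 \<union> E2). snd e \<le> d} = E1" by blast
      moreover have "e \<in> insert (d, u) (E1 \<union> E2) \<and> d < fst e \<longleftrightarrow> e \<in> E2" for e
        using r1[of "fst e" "snd e"] r2[of "fst e" "snd e"] d by (cases e) auto
      hence "{e \<in> insert (d, u) (E1 \<union> E2). d < fst e} = E2" by blast
      ultimately show "g (f (E1, E2)) = (E1, E2)"
        by (simp add: f_def g_def)
    qed
    show "\<forall>E\<in>?S. f (g E) = E"
    proof
      fix E assume "E \<in> ?S"
      hence "E = insert (d, u) ({e \<in> E. snd e \<le> d} \<union> {e \<in> E. d < fst e})"
        by (intro arcs_split(6)) auto
      thus "f (g E) = E" unfolding f_def g_def by simp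
    qed
    show "f ` (arcs p l (Suc d) \<times> arcs p (Suc d) u) \<subseteq> ?S"
      using arcs_join[OF d] by (auto simp: f_def)
    show "g ` ?S \<subseteq> arcs p l (Suc d) \<times> arcs p (Suc d) u"
    proof
      fix x assume "x \<in> g ` ?S"
      then obtain E where E: "E \<in> arcs p l (Suc u)" "(d, u) \<in> E" "x = g E" by blast
      show "x \<in> arcs p l (Suc d) \<times> arcs p (Suc d) u"
        using arcs_split(4,5)[OF E(1,2)] by (simp add: E(3) g_def)
    qed
  qed
  thus ?thesis by (simp add: bij_betw_same_card[symmetric] card_cartesian_product)
qed

lemma card_arcs_Suc:
  "card (arcs p l (Suc u)) = card (arcs p l u) +
     (\<Sum>d | l \<le> d \<and> Suc d < u \<and> p (Suc d) < p d. card (arcs p l (Suc d)) * card (arcs p (Suc d) u))"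
proof -
  let ?D = "{d. l \<le> d \<and> Suc d < u \<and> p (Suc d) < p d}"
  let ?A = "\<lambda>d. {E \<in> arcs p l (Suc u). (d, u) \<in> E}"
  have finD: "finite ?D" by (rule finite_subset[of _ "{..<u}"]) auto
  have nest: "d = d'" if "E \<in> arcs p l (Suc u)" "(d, u) \<in> E" "(d', u) \<in> E" for E d d'
    using arcsD(3,6)[OF that(1)] that(2,3) by (metis less_irrefl linorder_neqE_nat)
  have un: "arcs p l (Suc u) = arcs p l u \<union> (\<Union>d\<in>?D. ?A d)"
  proof (intro equalityI subsetI)
    fix E assume E: "E \<in> arcs p l (Suc u)"
    show "E \<in> arcs p l u \<union> (\<Union>d\<in>?D. ?A d)"
    proof (cases "u \<in> snd ` E")
      case True
      then obtain d where "(d, u) \<in> E" by auto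
      thus ?thesis using E arcs_split(1-3)[OF E] by blast
    next
      case False thus ?thesis using E arcs_extend by blast
    qed
  next
    fix E assume "E \<in> arcs p l u \<union> (\<Union>d\<in>?D. ?A d)"
    thus "E \<in> arcs p l (Suc u)" using arcs_extend by auto
  qed
  have disj: "arcs p l u \<inter> (\<Union>d\<in>?D. ?A d) = {}"
  proof -
    have "u \<in> snd ` E" if "(d, u) \<in> E" for d and E :: "(nat \<times> nat) set"
      using that by force
    thus ?thesis unfolding arcs_extend by blast
  qed
  have fin: "finite (\<Union>d\<in>?D. ?A d)" by (rule finite_UN_I[OF finD]) simp
  have "card (arcs p l (Suc u)) = card (arcs p l u \<union> (\<Union>d\<in>?D. ?A d))"
    by (rule arg_cong[OF un])
  also have "\<dots> = card (arcs p l u) + card (\<Union>d\<in>?D. ?A d)"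
    by (rule card_Un_disjoint[OF finite_arcs fin disj])
  also have "card (\<Union>d\<in>?D. ?A d) = (\<Sum>d\<in>?D. card (?A d))"
  proof (rule card_UN_disjoint[OF finD])
    show "\<forall>d\<in>?D. finite (?A d)" by simp
    show "\<forall>d\<in>?D. \<forall>d'\<in>?D. d \<noteq> d' \<longrightarrow> ?A d \<inter> ?A d' = {}"
    proof (intro ballI impI equals0I)
      fix d d' E assume "d \<noteq> d'" "E \<in> ?A d \<inter> ?A d'"
      thus False using nest[of E d d'] by simp
    qed
  qed
  also have "\<dots> = (\<Sum>d\<in>?D. card (arcs p l (Suc d)) * card (arcs p (Suc d) u))"
    by (intro sum.cong refl card_arcs_ending_at_last) simp_all
  finally show ?thesis .
qed

end

section \<open>Cutting at ascents\<close>

text \<open>The number of arc sets of a list of distinct entries, by the decomposition at the last entry.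
The empty list is given the value 0, although it has one (empty) configuration: lists are going to
be cut into nonempty segments, and this is the value for which empty segments do not contribute.\<close>

fun hook_count :: "nat list \<Rightarrow> nat" where
  "hook_count xs =
     (if xs = [] then 0 else if length xs = 1 then 1 else
      let ys = butlast xs in
      if \<forall>y\<in>set ys. y < last xs
      then hook_count ys + (\<Sum>d\<in>{1..<length ys}.
             if ys ! d < ys ! (d - 1) then hook_count (take d ys) * hook_count (drop d ys) else 0)
      else 0)"

declare hook_count.simps [simp del]

text \<open>The number of ways to cut a list at \<open>i\<close> ascents and to choose an arc set on each of the
\<open>i + 1\<close> segments. These numbers are needed because the decomposition of \<open>hook_count\<close> only cuts at
descents. Cuts at arbitrary places are easy to sum over all permutations, and the cuts at
ascents that have to be subtracted are counted by \<open>cut_count\<close> with one more cut.\<close>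

fun cut_count :: "nat \<Rightarrow> nat list \<Rightarrow> nat" where
  "cut_count 0 xs = hook_count xs"
| "cut_count (Suc i) xs = (\<Sum>d\<in>{1..<length xs}.
     if xs ! (d - 1) < xs ! d then cut_count i (take d xs) * hook_count (drop d xs) else 0)"

lemma hook_count_Nil [simp]: "hook_count [] = 0"
  by (simp add: hook_count.simps)

lemma hook_count_singleton [simp]: "hook_count [x] = 1"
  by (simp add: hook_count.simps)

lemma hook_count_snoc:
  assumes "ys \<noteq> []"
  shows "hook_count (ys @ [m]) =
     (if \<forall>y\<in>set ys. y < m
      then hook_count ys + (\<Sum>d\<in>{1..<length ys}.
             if ys ! d < ys ! (d - 1) then hook_count (take d ys) * hook_count (drop d ys) else 0)
      else 0)"
  using assms by (subst hook_count.simps) (simp add: Let_def)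

lemma hook_count_nonzero_imp_last_max:
  assumes "hook_count xs \<noteq> 0" "y \<in> set xs"
  shows "y \<le> last xs"
proof -
  have "xs \<noteq> []" using assms(1) by (intro notI) simp
  then obtain ys m where xs: "xs = ys @ [m]" by (metis rev_exhaust)
  show ?thesis
  proof (cases "ys = []")
    case False
    hence "\<forall>y\<in>set ys. y < m" using assms(1) unfolding xs by (simp add: hook_count_snoc split: if_splits)
    thus ?thesis using assms(2) by (auto simp: xs)
  qed (use assms in \<open>simp add: xs\<close>)
qed

lemma cut_count_nonzero_imp_last_max:
  "cut_count i xs \<noteq> 0 \<Longrightarrow> y \<in> set xs \<Longrightarrow> y \<le> last xs"
proof (induction i arbitrary: xs y)
  case 0
  thus ?case using hook_count_nonzero_imp_last_max by simp
next
  case (Suc i)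
  from Suc.prems(1) obtain d where d: "d \<in> {1..<length xs}" "xs ! (d - 1) < xs ! d"
    "cut_count i (take d xs) \<noteq> 0" "hook_count (drop d xs) \<noteq> 0"
    by (auto elim!: sum.not_neutral_contains_not_neutral split: if_splits)
  have right: "z \<le> last xs" if "z \<in> set (drop d xs)" for z
    using hook_count_nonzero_imp_last_max[OF d(4) that] d(1) by simp
  have "y \<in> set (take d xs) \<or> y \<in> set (drop d xs)"
    using Suc.prems(2) by (metis Un_iff append_take_drop_id set_append)
  thus ?case
  proof
    assume "y \<in> set (take d xs)"
    hence "y \<le> last (take d xs)" using Suc.IH[OF d(3)] by blast
    also have "last (take d xs) = xs ! (d - 1)" using d(1) by (subst last_conv_nth) auto
    also have "\<dots> \<le> xs ! d" using d(2) by simp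
    also have "\<dots> \<le> last xs"
      by (rule right) (use d(1) in \<open>simp add: Cons_nth_drop_Suc[symmetric]\<close>)
    finally show ?thesis .
  qed (rule right)
qed

text \<open>An additional last entry \<open>m\<close> exceeding all others may form a segment of its own, or it extends
the last segment. In the second case \<open>m\<close> is the end of no arc or of one arc. An arc to \<open>m\<close> splits
off the part right of a descent \<open>e\<close>; the part left of \<open>e\<close> keeps all the cuts. Summing
over all \<open>e\<close> instead of the descents only, one counts in addition the ascents \<open>e\<close> that can serve as
a further last cut, and this excess is the term \<open>cut_count (Suc i) ys\<close> on the left.\<close>

lemma cut_count_snoc:
  assumes dist: "distinct ys" and ne: "ys \<noteq> []" and max: "\<forall>y\<in>set ys. y < m"
  shows "cut_count i (ys @ [m]) + cut_count (Suc i) ys =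
    (if i = 0 then 0 else cut_count (i - 1) ys) + cut_count i ys
      + (\<Sum>e\<in>{1..<length ys}. cut_count i (take e ys) * hook_count (drop e ys))"
proof -
  let ?n = "length ys"
  let ?asc = "\<lambda>d. ys ! (d - 1) < ys ! d" and ?desc = "\<lambda>d. ys ! d < ys ! (d - 1)"
  have asc_desc: "?asc e \<longleftrightarrow> \<not> ?desc e" if "e \<in> {1..<?n}" for e
  proof -
    have "ys ! (e - 1) \<noteq> ys ! e" using dist that by (subst nth_eq_iff_index_eq) auto
    thus ?thesis by auto
  qed
  \<comment> \<open>every place is an ascent or a descent\<close>
  have compl: "(\<Sum>e\<in>{1..<?n}. cut_count i (take e ys) * hook_count (drop e ys)) =
      (\<Sum>e\<in>{1..<?n}. if ?desc e then cut_count i (take e ys) * hook_count (drop e ys) else 0)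
      + cut_count (Suc i) ys"
    unfolding cut_count.simps sum.distrib[symmetric]
    by (rule sum.cong[OF refl]) (use asc_desc in auto)
  have main: "cut_count i (ys @ [m]) = (if i = 0 then 0 else cut_count (i - 1) ys) + cut_count i ys
     + (\<Sum>e\<in>{1..<?n}. if ?desc e then cut_count i (take e ys) * hook_count (drop e ys) else 0)"
  proof (cases i)
    case 0 thus ?thesis using ne max by (simp add: hook_count_snoc cong: if_cong)
  next
    case (Suc k)
    \<comment> \<open>the last cut is at d; the last segment, extended by m, is decomposed at its descents e\<close>
    have snoc: "hook_count (drop d ys @ [m]) = hook_count (drop d ys) +
        (\<Sum>e\<in>{1..<?n}. if d < e then (if ?desc e
            then hook_count (drop d (take e ys)) * hook_count (drop e ys) else 0) else 0)"
      if d: "d \<in> {1..<?n}" for d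
    proof -
      have "hook_count (drop d ys @ [m]) = hook_count (drop d ys) +
        (\<Sum>e\<in>{1..<?n - d}. if ys ! (d + e) < ys ! (d + e - 1)
           then hook_count (take e (drop d ys)) * hook_count (drop e (drop d ys)) else 0)"
        using d max by (subst hook_count_snoc) (auto dest: in_set_dropD intro!: sum.cong)
      also have "(\<Sum>e\<in>{1..<?n - d}. if ys ! (d + e) < ys ! (d + e - 1)
           then hook_count (take e (drop d ys)) * hook_count (drop e (drop d ys)) else 0) =
         (\<Sum>e | e \<in> {1..<?n} \<and> d < e. if ?desc e
            then hook_count (drop d (take e ys)) * hook_count (drop e ys) else 0)"
        by (rule sum.reindex_bij_witness[of _ "\<lambda>e. e - d" "\<lambda>e. d + e"])
           (auto simp: drop_take add.commute)
      also have "\<dots> = (\<Sum>e\<in>{1..<?n}. if d < e then (if ?desc e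
            then hook_count (drop d (take e ys)) * hook_count (drop e ys) else 0) else 0)"
        by (rule sum.inter_filter) simp
      finally show ?thesis .
    qed
    have "cut_count i (ys @ [m]) = (\<Sum>d\<in>{1..<Suc ?n}. if (ys @ [m]) ! (d - 1) < (ys @ [m]) ! d
        then cut_count k (take d (ys @ [m])) * hook_count (drop d (ys @ [m])) else 0)"
      by (simp add: Suc)
    also have "\<dots> = cut_count k ys + (\<Sum>d\<in>{1..<?n}. if (ys @ [m]) ! (d - 1) < (ys @ [m]) ! d
        then cut_count k (take d (ys @ [m])) * hook_count (drop d (ys @ [m])) else 0)"
      using ne max by (simp add: sum.atLeastLessThan_Suc nth_append Suc_le_eq)
    also have "(\<Sum>d\<in>{1..<?n}. if (ys @ [m]) ! (d - 1) < (ys @ [m]) ! d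
        then cut_count k (take d (ys @ [m])) * hook_count (drop d (ys @ [m])) else 0) =
      (\<Sum>d\<in>{1..<?n}. (if ?asc d then cut_count k (take d ys) * hook_count (drop d ys) else 0) +
        (\<Sum>e\<in>{1..<?n}. if d < e \<and> ?asc d \<and> ?desc e
          then cut_count k (take d ys) * hook_count (drop d (take e ys)) * hook_count (drop e ys) else 0))"
    proof (rule sum.cong[OF refl])
      fix d assume d: "d \<in> {1..<?n}"
      show "(if (ys @ [m]) ! (d - 1) < (ys @ [m]) ! d
        then cut_count k (take d (ys @ [m])) * hook_count (drop d (ys @ [m])) else 0) =
        (if ?asc d then cut_count k (take d ys) * hook_count (drop d ys) else 0) +
        (\<Sum>e\<in>{1..<?n}. if d < e \<and> ?asc d \<and> ?desc e
          then cut_count k (take d ys) * hook_count (drop d (take e ys)) * hook_count (drop e ys) else 0)"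
      proof (cases "?asc d")
        case True
        thus ?thesis using d snoc[OF d]
          by (auto simp: nth_append distrib_left sum_distrib_left mult.assoc intro!: sum.cong)
      qed (use d in \<open>auto simp: nth_append\<close>)
    qed
    also have "\<dots> = cut_count i ys + (\<Sum>d\<in>{1..<?n}. \<Sum>e\<in>{1..<?n}. if d < e \<and> ?asc d \<and> ?desc e
          then cut_count k (take d ys) * hook_count (drop d (take e ys)) * hook_count (drop e ys) else 0)"
      by (simp add: Suc sum.distrib)
    also have "(\<Sum>d\<in>{1..<?n}. \<Sum>e\<in>{1..<?n}. if d < e \<and> ?asc d \<and> ?desc e
          then cut_count k (take d ys) * hook_count (drop d (take e ys)) * hook_count (drop e ys) else 0) =
        (\<Sum>e\<in>{1..<?n}. \<Sum>d\<in>{1..<?n}. if d < e \<and> ?asc d \<and> ?desc e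
          then cut_count k (take d ys) * hook_count (drop d (take e ys)) * hook_count (drop e ys) else 0)"
      by (rule sum.swap)
    \<comment> \<open>for fixed e, the cuts at d < e reassemble the cuts of the part left of e\<close>
    also have "\<dots> = (\<Sum>e\<in>{1..<?n}. if ?desc e then cut_count i (take e ys) * hook_count (drop e ys) else 0)"
    proof (rule sum.cong[OF refl])
      fix e assume e: "e \<in> {1..<?n}"
      have "(\<Sum>d\<in>{1..<?n}. if d < e \<and> ?asc d \<and> ?desc e
          then cut_count k (take d ys) * hook_count (drop d (take e ys)) * hook_count (drop e ys) else 0) =
        (\<Sum>d | d \<in> {1..<?n} \<and> d < e. if ?asc d \<and> ?desc e
          then cut_count k (take d ys) * hook_count (drop d (take e ys)) * hook_count (drop e ys) else 0)"
        by (subst sum.inter_filter) (auto intro!: sum.cong)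
      also have "{d. d \<in> {1..<?n} \<and> d < e} = {1..<e}" using e by auto
      also have "(\<Sum>d\<in>{1..<e}. if ?asc d \<and> ?desc e
          then cut_count k (take d ys) * hook_count (drop d (take e ys)) * hook_count (drop e ys) else 0) =
          (if ?desc e then cut_count i (take e ys) * hook_count (drop e ys) else 0)"
        using e by (auto simp: Suc sum_distrib_right min_def intro!: sum.cong)
      finally show "(\<Sum>d\<in>{1..<?n}. if d < e \<and> ?asc d \<and> ?desc e
          then cut_count k (take d ys) * hook_count (drop d (take e ys)) * hook_count (drop e ys) else 0) =
          (if ?desc e then cut_count i (take e ys) * hook_count (drop e ys) else 0)" .
    qed
    finally show ?thesis by (simp add: Suc)
  qed
  show ?thesis using main compl by simp
qed

lemma card_arcs_eq_hook_count:
  assumes "l < u" "inj_on p {l..<u}"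
  shows "card (arcs p l u) = hook_count (map p [l..<u])"
  using assms
proof (induction "u - l" arbitrary: l u rule: less_induct)
  case less
  obtain v where u: "u = Suc v" using less.prems by (cases u) auto
  show ?case
  proof (cases "l = v")
    case True thus ?thesis by (simp add: u arcs_singleton)
  next
    case False
    hence lv: "l < v" using less.prems u by simp
    have snoc: "map p [l..<u] = map p [l..<v] @ [p v]" using lv by (simp add: u)
    have ne: "map p [l..<v] \<noteq> []" using lv by simp
    show ?thesis
    proof (cases "\<forall>x\<in>{l..<v}. p x < p v")
      case False
      hence "arcs p l u = {}" using arcs_last_max less.prems(2) unfolding u by blast
      moreover have "hook_count (map p [l..<u]) = 0"
        unfolding snoc hook_count_snoc[OF ne] using False by auto
      ultimately show ?thesis by simp
    next
      case True
      hence max: "\<And>x. x \<in> {l..<v} \<Longrightarrow> p x < p v" by blast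
      have IH: "card (arcs p a b) = hook_count (map p [a..<b])" if "l \<le> a" "a < b" "b \<le> v" for a b
        by (rule less.hyps) (use that less.prems u in \<open>auto intro: inj_on_subset\<close>)
      have "card (arcs p l u) = hook_count (map p [l..<v]) +
         (\<Sum>d | l \<le> d \<and> Suc d < v \<and> p (Suc d) < p d.
            hook_count (map p [l..<Suc d]) * hook_count (map p [Suc d..<v]))"
      proof -
        have "card (arcs p l v) = hook_count (map p [l..<v])" using IH lv by blast
        moreover have "card (arcs p l (Suc d)) * card (arcs p (Suc d) v) =
            hook_count (map p [l..<Suc d]) * hook_count (map p [Suc d..<v])"
          if "d \<in> {d. l \<le> d \<and> Suc d < v \<and> p (Suc d) < p d}" for d
          using that IH[of l "Suc d"] IH[of "Suc d" v] by simp
        ultimately show ?thesis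
          unfolding u using card_arcs_Suc[of l v p, OF lv] max sum.cong[OF refl] by simp
      qed
      also have "(\<Sum>d | l \<le> d \<and> Suc d < v \<and> p (Suc d) < p d.
            hook_count (map p [l..<Suc d]) * hook_count (map p [Suc d..<v])) =
          (\<Sum>e | e \<in> {1..<v - l} \<and> p (l + e) < p (l + e - 1).
            hook_count (map p [l..<l + e]) * hook_count (map p [l + e..<v]))"
        by (rule sum.reindex_bij_witness[of _ "\<lambda>e. l + e - 1" "\<lambda>d. Suc d - l"]) auto
      also have "\<dots> = (\<Sum>e\<in>{1..<v - l}. if p (l + e) < p (l + e - 1)
           then hook_count (map p [l..<l + e]) * hook_count (map p [l + e..<v]) else 0)"
        by (rule sum.inter_filter) simp
      also have "\<dots> = (\<Sum>e\<in>{1..<length (map p [l..<v])}.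
            if map p [l..<v] ! e < map p [l..<v] ! (e - 1)
            then hook_count (take e (map p [l..<v])) * hook_count (drop e (map p [l..<v])) else 0)"
        by (rule sum.cong) (auto simp: take_map drop_map)
      finally show ?thesis
        unfolding snoc hook_count_snoc[OF ne] using True by simp
    qed
  qed
qed

text \<open>Permutations as functions on \<open>{1..n}\<close> are turned into lists of their values.\<close>

lemma card_VHC_S:
  assumes "n > 0"
  shows "card (VHC_S n) = (\<Sum>xs\<in>permutations_of_set {1..n}. hook_count xs)"
proof -
  let ?P = "{p. p permutes {1..n}}"
  let ?f = "\<lambda>p. map p [1..<Suc n]"
  have card: "card (VHC n p) = hook_count (?f p)" if "p permutes {1..n}" for p
  proof -
    have "card (VHC n p) = card (arcs p 1 (Suc n))"
      by (rule bij_betw_same_card[OF bij_betw_VHC_arcs])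
    also have "inj_on p {1..<Suc n}" using permutes_inj[OF that] by (rule inj_on_subset) simp
    hence "card (arcs p 1 (Suc n)) = hook_count (?f p)"
      using assms by (intro card_arcs_eq_hook_count) auto
    finally show ?thesis .
  qed
  have fin: "finite (VHC n p)" for p
    using bij_betw_finite[OF bij_betw_VHC_arcs] by simp
  have "card (VHC_S n) = (\<Sum>p\<in>?P. card (VHC n p))"
    unfolding VHC_S_def by (rule card_SigmaI) (auto simp: fin finite_permutations)
  also have "\<dots> = (\<Sum>p\<in>?P. hook_count (?f p))" by (simp add: card)
  also have "\<dots> = (\<Sum>xs\<in>permutations_of_set {1..n}. hook_count xs)"
  proof (rule sum.reindex_bij_betw)
    show "bij_betw ?f ?P (permutations_of_set {1..n})"
    proof (intro bij_betwI')
      fix p q assume pq: "p \<in> ?P" "q \<in> ?P"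
      show "(?f p = ?f q) = (p = q)"
      proof
        assume "?f p = ?f q"
        hence "\<forall>i\<in>set [1..<Suc n]. p i = q i" by (simp only: map_eq_conv)
        hence "p i = q i" if "i \<in> {1..n}" for i using that by (simp add: less_Suc_eq_le del: upt_Suc)
        moreover have "p i = q i" if "i \<notin> {1..n}" for i using that pq by (simp add: permutes_def)
        ultimately show "p = q" by blast
      qed simp
    next
      fix p assume p: "p \<in> ?P"
      have "set [1..<Suc n] = {1..n}" by auto
      thus "?f p \<in> permutations_of_set {1..n}"
        using p permutes_image[of p "{1..n}"] permutes_inj[of p "{1..n}"]
        by (auto simp: permutations_of_set_def distinct_map simp del: set_upt upt_Suc intro: inj_on_subset)
    next
      fix xs assume "xs \<in> permutations_of_set {1..n}"
      hence xs: "set xs = {1..n}" "distinct xs" by (auto simp: permutations_of_set_def)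
      have len: "length xs = n" using distinct_card[OF xs(2)] by (simp add: xs(1))
      define p where "p i = (if i \<in> {1..n} then xs ! (i - 1) else i)" for i
      have "bij_betw (\<lambda>i. xs ! (i - 1)) {1..n} {1..n}"
      proof -
        have "bij_betw (\<lambda>i. i - 1) {1..n} {..<n}"
          by (rule bij_betw_byWitness[of _ Suc]) auto
        moreover have "bij_betw (nth xs) {..<n} {1..n}"
          by (rule bij_betw_nth) (use xs len in auto)
        ultimately show ?thesis by (auto dest: bij_betw_trans simp: comp_def)
      qed
      hence "bij_betw p {1..n} {1..n}"
        by (rule bij_betw_cong[THEN iffD1, rotated]) (simp add: p_def)
      hence "p permutes {1..n}" by (rule bij_imp_permutes) (auto simp: p_def)
      moreover have "?f p = xs" 
        by (rule nth_equalityI) (auto simp: len p_def simp del: upt_Suc)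
      ultimately show "\<exists>p\<in>?P. xs = ?f p" by blast
    qed
  qed
  finally show ?thesis .
qed

section \<open>Summation over all permutations\<close>

definition cut_total :: "nat \<Rightarrow> nat set \<Rightarrow> nat" where
  "cut_total i S = (\<Sum>xs\<in>permutations_of_set S. cut_count i xs)"

text \<open>Cutting all permutations of \<open>S\<close> at place \<open>e\<close> amounts to choosing the set \<open>U\<close> of the first \<open>e\<close>
entries and, independently, a permutation of \<open>U\<close> and one of its complement.\<close>

lemma sum_permutations_split:
  fixes F G :: "nat list \<Rightarrow> nat"
  assumes S: "finite S" and e: "e \<le> card S"
  shows "(\<Sum>xs\<in>permutations_of_set S. F (take e xs) * G (drop e xs)) =
    (\<Sum>U | U \<subseteq> S \<and> card U = e.
       (\<Sum>ys\<in>permutations_of_set U. F ys) * (\<Sum>zs\<in>permutations_of_set (S - U). G zs))"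
proof -
  let ?I = "{U. U \<subseteq> S \<and> card U = e}"
  have fin: "finite ?I" using S by simp
  have len: "length xs = card S" if "xs \<in> permutations_of_set S" for xs
    using that by (simp add: length_finite_permutations_of_set)
  have "(\<Sum>U\<in>?I. (\<Sum>ys\<in>permutations_of_set U. F ys) * (\<Sum>zs\<in>permutations_of_set (S - U). G zs)) =
      (\<Sum>U\<in>?I. \<Sum>(ys, zs)\<in>permutations_of_set U \<times> permutations_of_set (S - U). F ys * G zs)"
    by (simp add: sum_product sum.cartesian_product)
  also have "\<dots> = (\<Sum>(U, ys, zs)\<in>(SIGMA U:?I. permutations_of_set U \<times> permutations_of_set (S - U)). F ys * G zs)"
    using fin by (subst sum.Sigma) auto
  also have "\<dots> = (\<Sum>xs\<in>permutations_of_set S. F (take e xs) * G (drop e xs))"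
  proof (rule sum.reindex_bij_witness[of _ "\<lambda>xs. (set (take e xs), take e xs, drop e xs)" "\<lambda>(U, ys, zs). ys @ zs"])
    fix a assume a: "a \<in> (SIGMA U:?I. permutations_of_set U \<times> permutations_of_set (S - U))"
    obtain U ys zs where eq: "a = (U, ys, zs)" by (cases a)
    have U: "U \<subseteq> S" "card U = e" "set ys = U" "distinct ys" "set zs = S - U" "distinct zs"
      using a by (auto simp: eq permutations_of_set_def)
    have "length ys = e" using U by (metis distinct_card)
    thus "(\<lambda>xs. (set (take e xs), take e xs, drop e xs)) (case a of (U, ys, zs) \<Rightarrow> ys @ zs) = a"
      "F (take e (case a of (U, ys, zs) \<Rightarrow> ys @ zs)) * G (drop e (case a of (U, ys, zs) \<Rightarrow> ys @ zs)) =
        (case a of (U, ys, zs) \<Rightarrow> F ys * G zs)"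
      using U by (auto simp: eq)
    show "(case a of (U, ys, zs) \<Rightarrow> ys @ zs) \<in> permutations_of_set S"
      using U by (auto simp: eq permutations_of_set_def)
  next
    fix xs assume xs: "xs \<in> permutations_of_set S"
    show "(case (set (take e xs), take e xs, drop e xs) of (U, ys, zs) \<Rightarrow> ys @ zs) = xs" by simp
    have d: "distinct xs" "set xs = S" using xs by (auto simp: permutations_of_set_def)
    have "set (take e xs) \<union> set (drop e xs) = S" "set (take e xs) \<inter> set (drop e xs) = {}"
      using d by (metis append_take_drop_id set_append) (simp add: d set_take_disj_set_drop_if_distinct)
    hence "set (drop e xs) = S - set (take e xs)" by blast
    moreover have "card (set (take e xs)) = e"
      using d e len[OF xs] by (simp add: distinct_card)
    ultimately show "(set (take e xs), take e xs, drop e xs) \<in> (SIGMA U:?I. permutations_of_set U \<times> permutations_of_set (S - U))"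
      using d set_take_subset[of e xs] by (auto simp: permutations_of_set_def)
  qed
  finally show ?thesis by simp
qed

lemma cut_total_drop_max:
  assumes S: "finite S" "S \<noteq> {}"
  shows "cut_total i S = (\<Sum>ys\<in>permutations_of_set (S - {Max S}). cut_count i (ys @ [Max S]))"
proof -
  let ?m = "Max S" and ?T = "S - {Max S}"
  have mS: "?m \<in> S" using S by simp
  have "(\<Sum>ys\<in>permutations_of_set ?T. cut_count i (ys @ [?m])) =
      (\<Sum>xs\<in>(\<lambda>ys. ys @ [?m]) ` permutations_of_set ?T. cut_count i xs)"
    by (subst sum.reindex) (auto simp: inj_on_def)
  also have "\<dots> = cut_total i S"
    unfolding cut_total_def
  proof (rule sum.mono_neutral_left)
    show "(\<lambda>ys. ys @ [?m]) ` permutations_of_set ?T \<subseteq> permutations_of_set S"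
    proof (rule image_subsetI)
      fix ys assume "ys \<in> permutations_of_set ?T"
      hence "set ys = ?T" "distinct ys" by (auto simp: permutations_of_set_def)
      thus "ys @ [?m] \<in> permutations_of_set S"
        by (simp add: permutations_of_set_def insert_absorb[OF mS])
    qed
    show "\<forall>xs\<in>permutations_of_set S - (\<lambda>ys. ys @ [?m]) ` permutations_of_set ?T. cut_count i xs = 0"
    proof (rule ballI, rule ccontr)
      fix xs assume xs: "xs \<in> permutations_of_set S - (\<lambda>ys. ys @ [?m]) ` permutations_of_set ?T"
        and nz: "cut_count i xs \<noteq> 0"
      have set: "set xs = S" and dist: "distinct xs" using xs by (auto simp: permutations_of_set_def)
      have "xs \<noteq> []" using set S by auto
      then obtain ys k where eq: "xs = ys @ [k]" by (metis rev_exhaust)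
      have "?m \<in> set xs" using mS by (simp add: set)
      hence "?m \<le> k" using cut_count_nonzero_imp_last_max[OF nz] by (simp add: eq)
      moreover have "k \<in> S" unfolding set[symmetric] by (simp add: eq)
      hence "k \<le> ?m" by (rule Max_ge[OF S(1)])
      ultimately have k: "k = ?m" by simp
      have "set ys = set xs - {k}" "distinct ys" using dist by (auto simp: eq)
      hence "ys \<in> permutations_of_set ?T"
        unfolding set k by (simp add: permutations_of_set_def)
      thus False using xs by (auto simp: eq k)
    qed
  qed simp
  finally show ?thesis by simp
qed

lemma cut_total_singleton: "cut_total i {x} = (if i = 0 then 1 else 0)"
  by (cases i) (simp_all add: cut_total_def)

lemma cut_total_rec:
  assumes S: "finite S" "2 \<le> card S"
  defines "T \<equiv> S - {Max S}"
  shows "cut_total i S + cut_total (Suc i) T =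
    (if i = 0 then 0 else cut_total (i - 1) T) + cut_total i T +
    (\<Sum>e\<in>{1..<card T}. \<Sum>U | U \<subseteq> T \<and> card U = e. cut_total i U * cut_total 0 (T - U))"
proof -
  have Sne: "S \<noteq> {}" using S by auto
  have T: "finite T" "card T = card S - 1" using S Sne by (auto simp: T_def)
  have step: "cut_count i (ys @ [Max S]) + cut_count (Suc i) ys =
    (if i = 0 then 0 else cut_count (i - 1) ys) + cut_count i ys
      + (\<Sum>e\<in>{1..<card T}. cut_count i (take e ys) * hook_count (drop e ys))"
    if "ys \<in> permutations_of_set T" for ys
  proof -
    have ys: "set ys = T" "distinct ys" using that by (auto simp: permutations_of_set_def)
    have len: "length ys = card T" using ys by (metis distinct_card)
    hence "ys \<noteq> []" using S T by auto
    moreover have "\<forall>y\<in>set ys. y < Max S"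
    proof
      fix y assume "y \<in> set ys"
      hence "y \<in> S" "y \<noteq> Max S" by (auto simp: ys T_def)
      thus "y < Max S" using S(1) by (meson Max_ge le_neq_implies_less)
    qed
    ultimately show ?thesis using cut_count_snoc[OF ys(2), of "Max S" i] by (simp add: len)
  qed
  have "cut_total i S + cut_total (Suc i) T =
    (\<Sum>ys\<in>permutations_of_set T. (if i = 0 then 0 else cut_count (i - 1) ys) + cut_count i ys
      + (\<Sum>e\<in>{1..<card T}. cut_count i (take e ys) * hook_count (drop e ys)))"
    unfolding cut_total_drop_max[OF S(1) Sne] cut_total_def[of "Suc i"]
      sum.distrib[symmetric] T_def[symmetric]
    by (rule sum.cong[OF refl step])
  also have "\<dots> = (if i = 0 then 0 else cut_total (i - 1) T) + cut_total i T +
     (\<Sum>e\<in>{1..<card T}. \<Sum>ys\<in>permutations_of_set T. cut_count i (take e ys) * hook_count (drop e ys))"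
    by (subst sum.swap) (simp add: sum.distrib cut_total_def)
  also have "(\<Sum>e\<in>{1..<card T}. \<Sum>ys\<in>permutations_of_set T. cut_count i (take e ys) * hook_count (drop e ys)) =
     (\<Sum>e\<in>{1..<card T}. \<Sum>U | U \<subseteq> T \<and> card U = e. cut_total i U * cut_total 0 (T - U))"
    using sum_permutations_split[OF T(1), of _ "cut_count i" hook_count]
    by (auto simp: cut_total_def intro!: sum.cong)
  finally show ?thesis .
qed

text \<open>The totals depend on the cardinality of \<open>S\<close> only, and they are determined by a
recurrence whose right-hand side uses smaller cardinalities only, although \<open>i\<close> increases in
its last term. No renumbering of entries is needed: the induction ranges over all finite sets of
entries at once.\<close>

lemma cut_total_eq_recurrence:
  fixes r :: "nat \<Rightarrow> nat \<Rightarrow> real"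
  assumes base: "\<And>i. r 1 i = (if i = 0 then 1 else 0)"
    and rec: "\<And>n i. 1 \<le> n \<Longrightarrow> r (Suc n) i = (if i = 0 then 0 else r n (i - 1)) + r n i
       + (\<Sum>e\<in>{1..<n}. real (n choose e) * (r e i * r (n - e) 0)) - r n (Suc i)"
  assumes S: "finite S" "S \<noteq> {}"
  shows "real (cut_total i S) = r (card S) i"
  using S
proof (induction "card S" arbitrary: S i rule: less_induct)
  case less
  show ?case
  proof (cases "card S = 1")
    case True
    then obtain x where "S = {x}" by (rule card_1_singletonE)
    thus ?thesis using base[of i] by (simp add: cut_total_singleton)
  next
    case False
    have c2: "2 \<le> card S" using False less.prems by (metis One_nat_def Suc_1 card_gt_0_iff Suc_leI le_neq_implies_less)
    define T where "T = S - {Max S}"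
    have T: "finite T" "Suc (card T) = card S"
      using less.prems c2 by (auto simp: T_def)
    have cT: "1 \<le> card T" using T c2 by simp
    hence Tne: "T \<noteq> {}" by auto
    have IH: "real (cut_total j U) = r (card U) j" if "U \<subseteq> T" "U \<noteq> {}" for U j
    proof (rule less.hyps)
      show "card U < card S" using card_mono[OF T(1) that(1)] T(2) by simp
      show "finite U" using that T finite_subset by blast
    qed (rule that(2))
    have inner: "(\<Sum>U | U \<subseteq> T \<and> card U = e. real (cut_total i U) * real (cut_total 0 (T - U))) =
        real (card T choose e) * (r e i * r (card T - e) 0)" if e: "e \<in> {1..<card T}" for e
    proof -
      have "(\<Sum>U | U \<subseteq> T \<and> card U = e. real (cut_total i U) * real (cut_total 0 (T - U))) =
         (\<Sum>U | U \<subseteq> T \<and> card U = e. r e i * r (card T - e) 0)"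
      proof (rule sum.cong[OF refl])
        fix U assume U: "U \<in> {U. U \<subseteq> T \<and> card U = e}"
        have "U \<noteq> {}" using U e by auto
        moreover have cd: "card (T - U) = card T - e"
          using U card_Diff_subset[of U T] finite_subset[OF _ T(1)] by auto
        moreover have "T - U \<noteq> {}" using cd e by (metis card.empty atLeastLessThan_iff less_irrefl zero_less_diff)
        ultimately show "real (cut_total i U) * real (cut_total 0 (T - U)) = r e i * r (card T - e) 0"
          using IH[of U i] IH[of "T - U" 0] U by simp
      qed
      thus ?thesis using n_subsets[OF T(1), of e] by simp
    qed
    have "real (cut_total i S) + real (cut_total (Suc i) T) =
       (if i = 0 then 0 else real (cut_total (i - 1) T)) + real (cut_total i T) +
       (\<Sum>e\<in>{1..<card T}. \<Sum>U | U \<subseteq> T \<and> card U = e. real (cut_total i U) * real (cut_total 0 (T - U)))"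
      using arg_cong[OF cut_total_rec[OF less.prems(1) c2, of i], of real] unfolding T_def[symmetric]
      by (simp split: if_splits)
    hence "real (cut_total i S) = r (Suc (card T)) i"
      using rec[OF cT, of i] inner IH[OF subset_refl Tne] by (simp split: if_splits)
    thus ?thesis using T(2) by simp
  qed
qed

section \<open>Solution of the differential system\<close>

unbundle no vec_syntax
unbundle fps_syntax

text \<open>The exponential generating function of the signed ballot numbers: \<open>n!\<close> times the \<open>n\<close>-th
coefficient is the sum over all walks of \<open>n\<close> steps \<open>\<plusminus>1\<close> on the nonnegative integers from \<open>0\<close> to \<open>i\<close>,
weighted by \<open>-1\<close> for each down step. As a function it is
\<open>(i + 1) J\<^bsub>i+1\<^esub>(2 z) / z\<close>, with the Bessel function \<open>J\<^bsub>i+1\<^esub>\<close>.\<close>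

definition ballot_fps :: "nat \<Rightarrow> real fps" where
  "ballot_fps i = Abs_fps (\<lambda>n. if i \<le> n \<and> even (n - i)
     then (-1) ^ ((n - i) div 2) * real (i + 1) / (fact ((n - i) div 2) * fact ((n - i) div 2 + i + 1))
     else 0)"

lemma ballot_fps_nth_add:
  "ballot_fps i $ (i + 2 * k) = (-1) ^ k * real (i + 1) / (fact k * fact (k + i + 1))"
  by (simp add: ballot_fps_def)

lemma ballot_fps_nth_eq_0:
  assumes "\<nexists>k. n = i + 2 * k"
  shows "ballot_fps i $ n = 0"
proof -
  have "\<not> (i \<le> n \<and> even (n - i))"
  proof
    assume "i \<le> n \<and> even (n - i)"
    hence "i \<le> n" "2 * ((n - i) div 2) = n - i" by (simp_all only: dvd_mult_div_cancel)
    hence "n = i + 2 * ((n - i) div 2)" by linarith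
    thus False using assms by blast
  qed
  thus ?thesis unfolding ballot_fps_def by (subst fps_nth_Abs_fps) (simp only: if_False)
qed

text \<open>The recurrence of the walks, according to the last step.\<close>

lemma fps_deriv_ballot:
  "fps_deriv (ballot_fps i) = (if i = 0 then 0 else ballot_fps (i - 1)) - ballot_fps (Suc i)"
proof (rule fps_ext)
  fix n
  show "fps_deriv (ballot_fps i) $ n = ((if i = 0 then 0 else ballot_fps (i - 1)) - ballot_fps (Suc i)) $ n"
  proof (cases "\<exists>k. Suc n = i + 2 * k")
    case False
    have "ballot_fps i $ Suc n = 0" using False by (intro ballot_fps_nth_eq_0) auto
    moreover have "ballot_fps (Suc i) $ n = 0"
    proof (rule ballot_fps_nth_eq_0, rule notI)
      assume "\<exists>k. n = Suc i + 2 * k"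
      then obtain k where "n = Suc i + 2 * k" ..
      hence "Suc n = i + 2 * Suc k" by simp
      thus False using False by blast
    qed
    moreover have "ballot_fps (i - 1) $ n = 0" if "i \<noteq> 0"
    proof (rule ballot_fps_nth_eq_0, rule notI)
      assume "\<exists>k. n = i - 1 + 2 * k"
      then obtain k where "n = i - 1 + 2 * k" ..
      hence "Suc n = i + 2 * k" using that by simp
      thus False using False by blast
    qed
    ultimately show ?thesis by simp
  next
    case True
    then obtain k where k: "Suc n = i + 2 * k" ..
    have lhs: "fps_deriv (ballot_fps i) $ n =
        real (i + 2 * k) * ((-1) ^ k * real (i + 1) / (fact k * fact (k + i + 1)))"
    proof -
      have "fps_deriv (ballot_fps i) $ n = of_nat (Suc n) * ballot_fps i $ Suc n" by simp
      thus ?thesis unfolding k ballot_fps_nth_add .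
    qed
    have down: "(if i = 0 then 0 else ballot_fps (i - 1)) $ n =
        real i * ((-1) ^ k * real (k + i + 1)) / (fact k * fact (k + i + 1))"
    proof (cases "i = 0")
      case False
      hence "n = (i - 1) + 2 * k" using k by simp
      hence "ballot_fps (i - 1) $ n = (-1) ^ k * real i / (fact k * fact (k + i))"
        using ballot_fps_nth_add[of "i - 1" k] False by simp
      thus ?thesis using False by (simp add: fact_Suc field_simps del: of_nat_Suc)
    qed simp
    have up: "ballot_fps (Suc i) $ n = - ((-1) ^ k * real (i + 2) * real k / (fact k * fact (k + i + 1)))"
    proof (cases k)
      case 0
      have "ballot_fps (Suc i) $ n = 0" using k 0 by (intro ballot_fps_nth_eq_0) auto
      thus ?thesis by (simp add: 0)
    next
      case (Suc j)
      hence "n = Suc i + 2 * j" using k by simp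
      hence "ballot_fps (Suc i) $ n = (-1) ^ j * real (i + 2) / (fact j * fact (j + i + 2))"
        using ballot_fps_nth_add[of "Suc i" j] by simp
      thus ?thesis by (simp add: Suc fact_Suc field_simps del: of_nat_Suc)
    qed
    have "fps_deriv (ballot_fps i) $ n - (if i = 0 then 0 else ballot_fps (i - 1)) $ n + ballot_fps (Suc i) $ n
      = (-1) ^ k / (fact k * fact (k + i + 1)) *
        (real (i + 2 * k) * real (i + 1) - real i * real (k + i + 1) - real (i + 2) * real k)"
    proof -
      have "a * (s * b / D) - c * (s * e) / D + - (s * g * h / D) = s / D * (a * b - c * e - g * h)"
        for a b c e g h s D :: real
        by (simp add: divide_inverse algebra_simps)
      thus ?thesis unfolding lhs down up .
    qed
    also have "real (i + 2 * k) * real (i + 1) - real i * real (k + i + 1) - real (i + 2) * real k = 0"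
      by (simp add: algebra_simps)
    finally show ?thesis by simp
  qed
qed

text \<open>The power series of \<open>1 - z F(1/2; 3/2, 2; -z\<^sup>2)\<close>, introduced as the antiderivative of
\<open>- ballot_fps 0\<close> with constant term \<open>1\<close>; its coefficients are compared with those of the
hypergeometric series below. Likewise, \<open>cut_numer i\<close> is the antiderivative of
\<open>ballot_fps i - ballot_fps (Suc i)\<close> with constant term \<open>0\<close>.\<close>

definition hook_denom :: "real fps" where
  "hook_denom = Abs_fps (\<lambda>n. if n = 0 then 1 else - (ballot_fps 0 $ (n - 1) / real n))"

definition cut_numer :: "nat \<Rightarrow> real fps" where
  "cut_numer i = Abs_fps (\<lambda>n. if n = 0 then 0 else (ballot_fps i - ballot_fps (Suc i)) $ (n - 1) / real n)"

lemma fps_deriv_hook_denom: "fps_deriv hook_denom = - ballot_fps 0"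
  by (rule fps_ext) (simp add: hook_denom_def)

lemma fps_deriv_cut_numer: "fps_deriv (cut_numer i) = ballot_fps i - ballot_fps (Suc i)"
  by (rule fps_ext) (simp add: cut_numer_def)

lemma hook_denom_nth_0 [simp]: "hook_denom $ 0 = 1"
  and cut_numer_nth_0 [simp]: "cut_numer i $ 0 = 0"
  by (simp_all add: hook_denom_def cut_numer_def)

lemma ballot_fps_nth_0: "ballot_fps i $ 0 = (if i = 0 then 1 else 0)"
  by (simp add: ballot_fps_def)

lemma fps_eq_if_deriv_eq:
  fixes f g :: "real fps"
  assumes "fps_deriv f = fps_deriv g" "f $ 0 = g $ 0"
  shows "f = g"
  using assms fps_deriv_eq_iff[of f g] by simp

text \<open>This identity and the next one make the linear system for the numerators close up. Both hold
because the two sides have the same derivative, by \<open>fps_deriv_ballot\<close>, and the same constant term.\<close>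

lemma cut_numer_0: "cut_numer 0 = - fps_deriv hook_denom - hook_denom"
  by (rule fps_eq_if_deriv_eq)
     (simp_all add: fps_deriv_cut_numer fps_deriv_hook_denom fps_deriv_ballot ballot_fps_nth_0 del: fps_deriv_nth)

lemma fps_deriv_cut_numer_system:
  "fps_deriv (cut_numer i) =
     (if i = 0 then hook_denom else cut_numer (i - 1)) - cut_numer (Suc i)"
proof (rule fps_eq_if_deriv_eq)
  show "fps_deriv (fps_deriv (cut_numer i)) =
      fps_deriv ((if i = 0 then hook_denom else cut_numer (i - 1)) - cut_numer (Suc i))"
    by (cases "i = 0"; simp add: fps_deriv_cut_numer fps_deriv_hook_denom fps_deriv_ballot)
  show "fps_deriv (cut_numer i) $ 0 = ((if i = 0 then hook_denom else cut_numer (i - 1)) - cut_numer (Suc i)) $ 0"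
    by (simp add: fps_deriv_cut_numer ballot_fps_nth_0 del: fps_deriv_nth)
qed

definition cut_fps :: "nat \<Rightarrow> real fps" where
  "cut_fps i = cut_numer i * inverse hook_denom"

lemma hook_denom_inverse: "hook_denom * inverse hook_denom = 1"
  by (simp add: inverse_mult_eq_1')

text \<open>Adding the constant term \<open>1\<close>, which stands for the empty permutation, gives a logarithmic
derivative. This is what linearizes the system: the product of \<open>cut_fps i\<close> with \<open>1 + cut_fps 0\<close>
is absorbed by multiplication with \<open>hook_denom\<close>.\<close>

lemma cut_fps_0: "1 + cut_fps 0 = - fps_deriv hook_denom * inverse hook_denom"
  using hook_denom_inverse by (simp add: cut_fps_def cut_numer_0 algebra_simps)

text \<open>The differential system that encodes the recurrence of \<open>cut_total_eq_recurrence\<close>.\<close>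

lemma fps_deriv_cut_fps:
  "fps_deriv (cut_fps i) =
     (if i = 0 then 1 else cut_fps (i - 1)) - cut_fps (Suc i) + cut_fps i * (1 + cut_fps 0)"
proof -
  have "fps_deriv (inverse hook_denom) = - fps_deriv hook_denom * inverse hook_denom * inverse hook_denom"
    by (simp add: fps_inverse_deriv power2_eq_square mult.assoc)
  hence "fps_deriv (cut_fps i) = fps_deriv (cut_numer i) * inverse hook_denom + cut_fps i * (1 + cut_fps 0)"
    unfolding cut_fps_0 by (simp add: cut_fps_def algebra_simps)
  also have "fps_deriv (cut_numer i) * inverse hook_denom =
      (if i = 0 then 1 else cut_fps (i - 1)) - cut_fps (Suc i)"
    unfolding fps_deriv_cut_numer_system
    using hook_denom_inverse by (simp add: left_diff_distrib cut_fps_def)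
  finally show ?thesis .
qed

lemma cut_fps_nth_0 [simp]: "cut_fps i $ 0 = 0"
  by (simp add: cut_fps_def)

lemma cut_total_eq_fps_coeff:
  assumes "finite S" "S \<noteq> {}"
  shows "real (cut_total i S) = fact (card S) * cut_fps i $ card S"
proof (rule cut_total_eq_recurrence[where r = "\<lambda>n i. fact n * cut_fps i $ n", OF _ _ assms])
  have coeff: "real (Suc n) * cut_fps i $ Suc n = (if i = 0 then 1 else cut_fps (i - 1)) $ n -
      cut_fps (Suc i) $ n + cut_fps i $ n + (cut_fps i * cut_fps 0) $ n" for n i
    using arg_cong[OF fps_deriv_cut_fps[of i], of "\<lambda>f. f $ n"] by (simp add: distrib_left)
  show "fact 1 * cut_fps i $ 1 = (if i = 0 then 1 else 0)" for i
    using coeff[of 0 i] by simp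
  show "fact (Suc n) * cut_fps i $ Suc n = (if i = 0 then 0 else fact n * cut_fps (i - 1) $ n)
      + fact n * cut_fps i $ n
      + (\<Sum>e\<in>{1..<n}. real (n choose e) * (fact e * cut_fps i $ e * (fact (n - e) * cut_fps 0 $ (n - e))))
      - fact n * cut_fps (Suc i) $ n" if n: "1 \<le> n" for n i
  proof -
    have "(cut_fps i * cut_fps 0) $ n = (\<Sum>e\<in>{0..n}. cut_fps i $ e * cut_fps 0 $ (n - e))"
      by (simp add: fps_mult_nth)
    \<comment> \<open>the constant terms vanish, so cuts at either end do not contribute\<close>
    also have "\<dots> = (\<Sum>e\<in>{1..<n}. cut_fps i $ e * cut_fps 0 $ (n - e))"
    proof (rule sum.mono_neutral_right)
      show "\<forall>e\<in>{0..n} - {1..<n}. cut_fps i $ e * cut_fps 0 $ (n - e) = 0"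
      proof
        fix e assume "e \<in> {0..n} - {1..<n}"
        hence "e = 0 \<or> e = n" by auto
        thus "cut_fps i $ e * cut_fps 0 $ (n - e) = 0" by auto
      qed
    qed auto
    finally have conv: "fact n * (cut_fps i * cut_fps 0) $ n =
        (\<Sum>e\<in>{1..<n}. fact n * (cut_fps i $ e * cut_fps 0 $ (n - e)))"
      by (simp add: sum_distrib_left)
    have binom: "fact n * (cut_fps i $ e * cut_fps 0 $ (n - e)) =
        real (n choose e) * (fact e * cut_fps i $ e * (fact (n - e) * cut_fps 0 $ (n - e)))"
      if "e \<in> {1..<n}" for e
      using that by (simp add: binomial_fact)
    have "fact (Suc n) * cut_fps i $ Suc n = fact n * (real (Suc n) * cut_fps i $ Suc n)"
      by (simp add: algebra_simps)
    also have "\<dots> = fact n * (if i = 0 then 1 else cut_fps (i - 1)) $ n - fact n * cut_fps (Suc i) $ n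
        + fact n * cut_fps i $ n + fact n * (cut_fps i * cut_fps 0) $ n"
      unfolding coeff by (simp add: algebra_simps)
    also have "fact n * (if i = 0 then 1 else cut_fps (i - 1)) $ n =
        (if i = 0 then 0 else fact n * cut_fps (i - 1) $ n)" using n by simp
    finally show ?thesis unfolding conv using binom by simp
  qed
qed

section \<open>Location of the root\<close>

text \<open>The coefficients of the hypergeometric function in question; up to sign also those of the
antiderivative of \<open>J\<^sub>1(2 z) / z\<close>.\<close>

definition bessel_coeff :: "nat \<Rightarrow> real" where
  "bessel_coeff k = 1 / (real (2 * k + 1) * fact k * fact (k + 1))"

lemma hook_denom_nth_odd: "hook_denom $ (2 * k + 1) = - ((-1) ^ k * bessel_coeff k)"
proof -
  have "hook_denom $ (2 * k + 1) = - (ballot_fps 0 $ (0 + 2 * k) / real (2 * k + 1))"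
    by (simp add: hook_denom_def)
  thus ?thesis unfolding ballot_fps_nth_add by (simp add: bessel_coeff_def mult_ac)
qed

lemma hook_denom_nth_even: "n > 0 \<Longrightarrow> even n \<Longrightarrow> hook_denom $ n = 0"
  by (simp add: hook_denom_def ballot_fps_def)

lemma bessel_coeff_pos: "bessel_coeff k > 0"
  by (simp add: bessel_coeff_def)

text \<open>The quotient of consecutive coefficients is at most \<open>1/16\<close> from \<open>k = 2\<close> on; the constant
\<open>9/2\<close> is large enough for the first three coefficients. The rate \<open>16\<close> becomes \<open>4\<close> for the
coefficients of \<open>hook_denom\<close>, which are enumerated by odd exponents, and leaves room beyond
the root near \<open>1.33\<close>.\<close>

lemma bessel_coeff_le: "bessel_coeff k \<le> 9/2 / 16 ^ k"
proof (cases "k < 2")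
  case True
  hence "k = 0 \<or> k = 1" by auto
  thus ?thesis by (auto simp: bessel_coeff_def)
next
  case False
  hence "2 \<le> k" by simp
  thus ?thesis
  proof (induction k rule: dec_induct)
    case base
    show ?case by (simp add: bessel_coeff_def fact_numeral)
  next
    case (step k)
    have "bessel_coeff (Suc k) = bessel_coeff k * (real (2 * k + 1) / (real (2 * k + 3) * (real k + 1) * (real k + 2)))"
      by (simp add: bessel_coeff_def divide_simps del: of_nat_add of_nat_mult) (simp add: algebra_simps)
    also have "\<dots> \<le> bessel_coeff k * (1 / 16)"
    proof (rule mult_left_mono)
      have k: "real k \<ge> 2" using step by simp
      have "16 * real (2 * k + 1) \<le> real (2 * k + 3) * ((real k + 1) * (real k + 2))"
      proof -
        \<comment> \<open>division with remainder by k - 2\<close>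
        have "real (2 * k + 3) * ((real k + 1) * (real k + 2)) - 16 * real (2 * k + 1)
            = (real k - 2) * (2 * (real k)\<^sup>2 + 13 * real k + 7) + 4"
          by (simp add: algebra_simps power2_eq_square)
        also have "\<dots> \<ge> 0" using k by (intro add_nonneg_nonneg mult_nonneg_nonneg) auto
        finally show ?thesis by simp
      qed
      thus "real (2 * k + 1) / (real (2 * k + 3) * (real k + 1) * (real k + 2)) \<le> 1 / 16"
        by (simp add: divide_simps mult.assoc)
    qed (simp add: less_imp_le bessel_coeff_pos)
    also have "\<dots> \<le> 9/2 / 16 ^ Suc k" using step.IH by (simp add: divide_simps)
    finally show ?case .
  qed
qed

lemma abs_hook_denom_le: "\<bar>hook_denom $ n\<bar> \<le> 18 / 4 ^ n"
proof (cases "even n")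
  case True
  thus ?thesis by (cases "n = 0") (simp_all add: hook_denom_nth_even)
next
  case False
  then obtain k where n: "n = 2 * k + 1" by (elim oddE)
  have "\<bar>hook_denom $ n\<bar> = bessel_coeff k"
    unfolding n hook_denom_nth_odd using bessel_coeff_pos[of k] by (simp add: abs_mult)
  also have "\<dots> \<le> 18 / 4 ^ n" using bessel_coeff_le[of k] by (simp add: n power_mult)
  finally show ?thesis .
qed

lemma hypergeo_term:
  "pochhammer (1/2) k / (pochhammer (3/2) k * pochhammer 2 k) * (w ^ k / fact k) = bessel_coeff k * w ^ k"
  for w :: real
proof -
  have half: "pochhammer (1/2 :: real) k * real (2 * k + 1) = pochhammer (3/2) k"
    by (induction k) (simp_all add: pochhammer_Suc field_simps)
  have two: "pochhammer (2 :: real) k = fact (k + 1)"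
    by (induction k) (simp_all add: pochhammer_Suc field_simps)
  have "pochhammer (1/2 :: real) k \<noteq> 0" by (auto simp: pochhammer_eq_0_iff)
  moreover have "p / (p * a * b) * (x / f) = 1 / (a * f * b) * x" if "p \<noteq> 0" for p a b x f :: real
    using that by simp
  ultimately show ?thesis unfolding half[symmetric] two bessel_coeff_def by blast
qed

lemma bessel_term_le:
  assumes "\<bar>w\<bar> \<le> 2"
  shows "norm (bessel_coeff k * w ^ k) \<le> 9/2 * (1/8) ^ k"
proof -
  have "norm (bessel_coeff k * w ^ k) = bessel_coeff k * \<bar>w\<bar> ^ k"
    using bessel_coeff_pos[of k] by (simp add: abs_mult power_abs)
  also have "\<dots> \<le> (9/2 / 16 ^ k) * 2 ^ k"
    by (intro mult_mono bessel_coeff_le power_mono) (use assms in auto)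
  also have "\<dots> = 9/2 * (2 / 16) ^ k" by (simp only: power_divide times_divide_eq_left times_divide_eq_right)
  finally show ?thesis by simp
qed

lemma bessel_summable:
  assumes "\<bar>w\<bar> \<le> 2"
  shows "summable (\<lambda>k. bessel_coeff k * w ^ k)"
  by (rule summable_comparison_test'[where g = "\<lambda>k. 9/2 * (1/8) ^ k" and N = 0])
     (use bessel_term_le[OF assms] in \<open>auto intro: summable_mult summable_geometric\<close>)

lemma hypergeo_sums:
  assumes "\<bar>w\<bar> \<le> 2"
  shows "(\<lambda>k. bessel_coeff k * w ^ k) sums hypergeo_1F2 (1/2) (3/2) 2 w"
  using bessel_summable[OF assms] unfolding hypergeo_1F2_def hypergeo_term by (rule summable_sums)

definition root_fun :: "real \<Rightarrow> real" where
  "root_fun z = 1 - z * hypergeo_1F2 (1/2) (3/2) 2 (- (z\<^sup>2))"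

lemma root_fun_sums:
  assumes "z\<^sup>2 \<le> 2"
  shows "(\<lambda>n. hook_denom $ n * z ^ n) sums root_fun z"
proof -
  have "(\<lambda>k. - z * (bessel_coeff k * (- (z\<^sup>2)) ^ k)) sums (- z * hypergeo_1F2 (1/2) (3/2) 2 (- (z\<^sup>2)))"
    by (intro sums_mult hypergeo_sums) (use assms in simp)
  hence "(\<lambda>n. if even n then 0 else - z * (bessel_coeff ((n - 1) div 2) * (- (z\<^sup>2)) ^ ((n - 1) div 2)))
      sums (- z * hypergeo_1F2 (1/2) (3/2) 2 (- (z\<^sup>2)))"
    by (rule sums_if')
  moreover have "(\<lambda>n. if n = 0 then 1 else 0) sums (1 :: real)"
    using sums_single[of 0 "\<lambda>_. 1 :: real"] by simp
  ultimately have "(\<lambda>n. (if n = 0 then 1 else 0) +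
      (if even n then 0 else - z * (bessel_coeff ((n - 1) div 2) * (- (z\<^sup>2)) ^ ((n - 1) div 2)))) sums root_fun z"
    unfolding root_fun_def using sums_add by force
  also have "(\<lambda>n. (if n = 0 then 1 else 0) +
      (if even n then 0 else - z * (bessel_coeff ((n - 1) div 2) * (- (z\<^sup>2)) ^ ((n - 1) div 2)))) =
    (\<lambda>n. hook_denom $ n * z ^ n)"
  proof
    fix n
    show "(if n = 0 then 1 else 0) +
      (if even n then 0 else - z * (bessel_coeff ((n - 1) div 2) * (- (z\<^sup>2)) ^ ((n - 1) div 2))) =
      hook_denom $ n * z ^ n"
    proof (cases "even n")
      case True
      thus ?thesis by (cases "n = 0") (simp_all add: hook_denom_nth_even)
    next
      case False
      then obtain k where n: "n = 2 * k + 1" by (elim oddE)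
      have "(- (z\<^sup>2)) ^ k = (-1) ^ k * z ^ (2 * k)" by (simp add: power_mult power_minus[of "z\<^sup>2"])
      thus ?thesis using hook_denom_nth_odd[of k] by (simp add: n)
    qed
  qed
  finally show ?thesis .
qed

lemma hypergeo_approx:
  assumes "\<bar>w\<bar> \<le> 2"
  shows "\<bar>hypergeo_1F2 (1/2) (3/2) 2 w - (\<Sum>k<N. bessel_coeff k * w ^ k)\<bar> \<le> 6 * (1/8) ^ N"
proof -
  let ?t = "\<lambda>k. bessel_coeff k * w ^ k"
  have sm: "summable ?t" by (rule bessel_summable[OF assms])
  have "hypergeo_1F2 (1/2) (3/2) 2 w - (\<Sum>k<N. ?t k) = (\<Sum>k. ?t (k + N))"
    using hypergeo_sums[OF assms] by (simp add: suminf_minus_initial_segment[OF sm] sums_iff)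
  also have "\<bar>\<dots>\<bar> \<le> (\<Sum>k. 9/2 * (1/8) ^ N * (1/8) ^ k)"
    unfolding real_norm_def[symmetric]
  proof (rule norm_suminf_le)
    show "norm (?t (k + N)) \<le> 9/2 * (1/8) ^ N * (1/8) ^ k" for k
      using bessel_term_le[OF assms, of "k + N"] by (simp add: power_add mult_ac)
    show "summable (\<lambda>k. 9/2 * (1/8) ^ N * (1/8 :: real) ^ k)"
      by (intro summable_mult summable_geometric) simp
  qed
  also have "(\<Sum>k. 9/2 * (1/8) ^ N * (1/8 :: real) ^ k) = 9/2 * (1/8) ^ N * (8/7)"
    by (subst suminf_mult) (simp_all add: suminf_geometric summable_geometric)
  also have "\<dots> \<le> 6 * (1/8) ^ N" by simp
  finally show ?thesis .
qed

text \<open>Nine terms of the series determine the sign of \<open>root_fun\<close> at both ends of an interval of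
length \<open>10^-5\<close>: the values there are about \<open>2.5 * 10^-6\<close> and \<open>-0.9 * 10^-6\<close>, the error is below
\<open>10^-7\<close>.\<close>

lemma root_fun_low: "root_fun (1328735/1000000) > 0"
proof -
  let ?z = "1328735/1000000 :: real"
  have "\<bar>hypergeo_1F2 (1/2) (3/2) 2 (- (?z\<^sup>2)) - (\<Sum>k<9. bessel_coeff k * (- (?z\<^sup>2)) ^ k)\<bar> \<le> 6 * (1/8) ^ 9"
    by (rule hypergeo_approx) (simp add: power2_eq_square)
  moreover have "?z * ((\<Sum>k<9. bessel_coeff k * (- (?z\<^sup>2)) ^ k) + 6 * (1/8) ^ 9) < 1"
    by (simp add: bessel_coeff_def lessThan_nat_numeral lessThan_Suc fact_numeral power_divide power2_eq_square)
  ultimately show ?thesis unfolding root_fun_def by (simp add: algebra_simps)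
qed

lemma root_fun_high: "root_fun (1328745/1000000) < 0"
proof -
  let ?z = "1328745/1000000 :: real"
  have "\<bar>hypergeo_1F2 (1/2) (3/2) 2 (- (?z\<^sup>2)) - (\<Sum>k<9. bessel_coeff k * (- (?z\<^sup>2)) ^ k)\<bar> \<le> 6 * (1/8) ^ 9"
    by (rule hypergeo_approx) (simp add: power2_eq_square)
  moreover have "?z * ((\<Sum>k<9. bessel_coeff k * (- (?z\<^sup>2)) ^ k) - 6 * (1/8) ^ 9) > 1"
    by (simp add: bessel_coeff_def lessThan_nat_numeral lessThan_Suc fact_numeral power_divide power2_eq_square)
  ultimately show ?thesis unfolding root_fun_def by (simp add: algebra_simps)
qed

lemma root_fun_root_exists:
  "\<exists>c. 1328735/1000000 < c \<and> c < 1328745/1000000 \<and> root_fun c = 0"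
proof -
  let ?a = "1328735/1000000 :: real" and ?b = "1328745/1000000 :: real"
  have cont: "isCont root_fun z" if "?a \<le> z" "z \<le> ?b" for z
  proof -
    have K: "summable (\<lambda>n. hook_denom $ n * (14/10) ^ n)"
      using root_fun_sums[of "14/10"] by (auto simp: sums_iff power2_eq_square)
    have "isCont (\<lambda>x. \<Sum>n. hook_denom $ n * x ^ n) z"
      by (rule isCont_powser[OF K]) (use that in auto)
    moreover have "eventually (\<lambda>x. root_fun x = (\<Sum>n. hook_denom $ n * x ^ n)) (nhds z)"
    proof -
      have "eventually (\<lambda>x. x \<in> {0<..<14/10}) (nhds z)"
        by (rule eventually_nhds_in_open) (use that in auto)
      thus ?thesis
      proof eventually_elim
        case (elim x)
        have "x\<^sup>2 \<le> (14/10)\<^sup>2" by (rule power_mono) (use elim in auto)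
        hence "x\<^sup>2 \<le> 2" by (simp add: power2_eq_square)
        thus ?case using root_fun_sums[of x] by (simp add: sums_iff)
      qed
    qed
    ultimately show ?thesis by (simp add: isCont_cong)
  qed
  obtain c where c: "?a \<le> c" "c \<le> ?b" "root_fun c = 0"
    using IVT2[of root_fun ?b 0 ?a] root_fun_low root_fun_high cont by auto
  moreover have "c \<noteq> ?a" "c \<noteq> ?b" using c(3) root_fun_low root_fun_high by (metis less_irrefl)+
  ultimately show ?thesis by (intro exI[of _ c]) auto
qed

section \<open>Asymptotics of the coefficients\<close>

text \<open>If the coefficients of \<open>q - 1\<close>, weighted by \<open>r ^ k\<close>, have absolute sum at most \<open>\<theta> < 1\<close>, then
\<open>q\<close> has no zero in the disc of radius \<open>r\<close>, and a quotient \<open>b = g / q\<close> inherits growth of order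
\<open>r ^ -n\<close> from \<open>g\<close>. On coefficients this is a direct induction on \<open>b $ n = g $ n - (\<Sum>k = 1..n. q $ k * b $ (n - k))\<close>.\<close>

lemma fps_inverse_coeff_bound:
  fixes q b g :: "real fps" and r \<theta> G :: real
  assumes r: "r > 0" and q0: "q $ 0 = 1" and prod: "b * q = g"
    and small: "\<And>N. (\<Sum>k\<in>{1..N}. \<bar>q $ k\<bar> * r ^ k) \<le> \<theta>" and \<theta>: "\<theta> < 1"
    and g: "\<And>n. \<bar>g $ n\<bar> * r ^ n \<le> G"
  shows "\<bar>b $ n\<bar> * r ^ n \<le> G / (1 - \<theta>)"
proof (induction n rule: less_induct)
  case (less n)
  let ?K = "G / (1 - \<theta>)"
  have G0: "G \<ge> 0" using order_trans[OF _ g[of 0]] by simp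
  have K0: "?K \<ge> 0" using G0 \<theta> by simp
  have "g $ n = (\<Sum>k=0..n. q $ k * b $ (n - k))"
    using prod by (metis fps_mult_nth mult.commute)
  also have "\<dots> = b $ n + (\<Sum>k\<in>{1..n}. q $ k * b $ (n - k))"
    by (subst sum.atLeast_Suc_atMost) (simp_all add: q0)
  finally have "\<bar>b $ n\<bar> * r ^ n = \<bar>g $ n - (\<Sum>k\<in>{1..n}. q $ k * b $ (n - k))\<bar> * r ^ n" by simp
  also have "\<dots> \<le> (\<bar>g $ n\<bar> + \<bar>\<Sum>k\<in>{1..n}. q $ k * b $ (n - k)\<bar>) * r ^ n"
    using r by (intro mult_right_mono) auto
  also have "\<dots> \<le> (\<bar>g $ n\<bar> + (\<Sum>k\<in>{1..n}. \<bar>q $ k * b $ (n - k)\<bar>)) * r ^ n"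
    using r by (intro mult_right_mono add_left_mono sum_abs) auto
  also have "\<dots> = \<bar>g $ n\<bar> * r ^ n + (\<Sum>k\<in>{1..n}. (\<bar>q $ k\<bar> * r ^ k) * (\<bar>b $ (n - k)\<bar> * r ^ (n - k)))"
  proof -
    have "r ^ n = r ^ k * r ^ (n - k)" if "k \<in> {1..n}" for k
      using that by (simp flip: power_add)
    hence "(\<Sum>k\<in>{1..n}. \<bar>q $ k * b $ (n - k)\<bar>) * r ^ n =
        (\<Sum>k\<in>{1..n}. (\<bar>q $ k\<bar> * r ^ k) * (\<bar>b $ (n - k)\<bar> * r ^ (n - k)))"
      unfolding sum_distrib_right by (intro sum.cong refl) (simp add: abs_mult mult_ac)
    thus ?thesis by (simp add: distrib_right)
  qed
  also have "\<dots> \<le> G + (\<Sum>k\<in>{1..n}. (\<bar>q $ k\<bar> * r ^ k) * ?K)"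
    using r by (intro add_mono g sum_mono mult_left_mono less.IH) auto
  also have "\<dots> = G + (\<Sum>k\<in>{1..n}. \<bar>q $ k\<bar> * r ^ k) * ?K"
    by (simp only: sum_distrib_right)
  also have "\<dots> \<le> G + \<theta> * ?K"
    by (intro add_left_mono mult_right_mono small K0)
  also have "\<dots> = ?K" using \<theta> by (simp add: field_simps)
  finally show ?case .
qed

locale root_fun_root =
  fixes c :: real
  assumes c_gt: "1328735/1000000 < c" and c_lt: "c < 1328745/1000000" and root: "root_fun c = 0"
begin

text \<open>The quotient of \<open>hook_denom\<close> by the linear factor \<open>1 - z / c\<close> of its root.\<close>

definition cofactor :: "real fps" where
  "cofactor = Abs_fps (\<lambda>n. (\<Sum>k\<le>n. hook_denom $ k * c ^ k) / c ^ n)"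

lemma c_pos: "c > 0" using c_gt by simp

lemma cofactor_0 [simp]: "cofactor $ 0 = 1"
  by (simp add: cofactor_def)

lemma cofactor_Suc: "cofactor $ Suc n = cofactor $ n / c + hook_denom $ Suc n"
  using c_pos by (simp add: cofactor_def add_divide_distrib divide_divide_eq_left mult.commute)

lemma hook_denom_factor: "hook_denom = (1 - fps_const (1 / c) * fps_X) * cofactor"
proof (rule fps_ext)
  fix n show "hook_denom $ n = ((1 - fps_const (1 / c) * fps_X) * cofactor) $ n"
    by (cases n) (simp_all add: left_diff_distrib mult.assoc cofactor_Suc)
qed

lemma c_sq_le: "c\<^sup>2 \<le> 2"
proof -
  have "c\<^sup>2 \<le> (14/10)\<^sup>2" by (rule power_mono) (use c_lt c_pos in auto)
  thus ?thesis by (simp add: power2_eq_square)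
qed

text \<open>Since \<open>c\<close> is a root, the partial sum in the definition of \<open>cofactor\<close> is minus the tail of
the same series, so that the coefficients decay as fast as those of \<open>hook_denom\<close>.\<close>

lemma abs_cofactor_le: "\<bar>cofactor $ n\<bar> \<le> 9 / 4 ^ n"
proof -
  let ?t = "\<lambda>k. hook_denom $ k * c ^ k"
  have "?t sums 0" using root_fun_sums[OF c_sq_le] root by simp
  hence sm: "summable ?t" and z: "suminf ?t = 0" by (simp_all add: sums_iff)
  have "(\<Sum>k\<le>n. ?t k) = - (\<Sum>k. ?t (k + Suc n))"
    using suminf_minus_initial_segment[OF sm, of "Suc n"] z by (simp only: lessThan_Suc_atMost)
  hence "\<bar>\<Sum>k\<le>n. ?t k\<bar> = norm (\<Sum>k. ?t (k + Suc n))" by simp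
  also have "\<dots> \<le> (\<Sum>k. 18 * (c / 4) ^ Suc n * (1 / 3) ^ k)"
  proof (rule norm_suminf_le)
    fix k
    have "norm (?t (k + Suc n)) = \<bar>hook_denom $ (k + Suc n)\<bar> * c ^ (k + Suc n)"
      using c_pos by (simp add: abs_mult)
    also have "\<dots> \<le> 18 / 4 ^ (k + Suc n) * c ^ (k + Suc n)"
      using c_pos by (intro mult_right_mono abs_hook_denom_le) simp
    also have "\<dots> = 18 * (c / 4) ^ Suc n * (c / 4) ^ k"
      by (simp add: power_add power_divide mult_ac)
    also have "\<dots> \<le> 18 * (c / 4) ^ Suc n * (1 / 3) ^ k"
      using c_pos c_lt by (intro mult_left_mono power_mono) auto
    finally show "norm (?t (k + Suc n)) \<le> 18 * (c / 4) ^ Suc n * (1 / 3) ^ k" .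
  qed (intro summable_mult summable_geometric, simp)
  also have "\<dots> = 18 * (c / 4) ^ Suc n * (3 / 2)"
    by (subst suminf_mult) (simp_all add: suminf_geometric summable_geometric)
  also have "\<dots> = c ^ n * ((27 / 4 * c) / 4 ^ n)"
    by (simp add: power_divide)
  \<comment> \<open>c < 4/3\<close>
  also have "\<dots> \<le> c ^ n * (9 / 4 ^ n)"
    using c_pos c_lt by (intro mult_left_mono divide_right_mono) auto
  finally show ?thesis using c_pos by (simp add: cofactor_def pos_divide_le_eq mult.commute)
qed

text \<open>The radius \<open>7/5\<close> exceeds \<open>c\<close>, which is what makes \<open>c\<close> the only singularity that counts. The
first five coefficients are polynomials in \<open>1 / c\<close> and give about \<open>0.87\<close>; the remaining ones
are dominated by a geometric series with ratio \<open>7/20\<close>.\<close>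

lemma cofactor_tail_small: "(\<Sum>k\<in>{1..N}. \<bar>cofactor $ k\<bar> * (7/5) ^ k) \<le> 9/10"
proof -
  define y where "y = 1 / c"
  have y: "7525/10000 \<le> y" "y \<le> 7527/10000"
    using c_gt c_lt by (simp_all add: y_def field_simps)
  have y2: "(7525/10000)\<^sup>2 \<le> y\<^sup>2" "y\<^sup>2 \<le> (7527/10000)\<^sup>2"
    using y by (auto intro!: power_mono)
  have h: "hook_denom $ 1 = -1" "hook_denom $ 2 = 0" "hook_denom $ 3 = 1/6" "hook_denom $ 4 = 0"
    "hook_denom $ 5 = -1/60"
    using hook_denom_nth_odd[of 0] hook_denom_nth_odd[of 1] hook_denom_nth_odd[of 2]
    by (simp_all add: hook_denom_nth_even bessel_coeff_def fact_numeral)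
  have S: "cofactor $ Suc n = cofactor $ n * y + hook_denom $ Suc n" for n
    by (simp add: cofactor_Suc y_def)
  have q1: "cofactor $ 1 = y - 1" using S[of 0] h by simp
  have q2: "cofactor $ 2 = (y - 1) * y" using S[of 1] h q1 by (simp add: numeral_2_eq_2)
  have q3: "cofactor $ 3 = 1/6 - y\<^sup>2 * (1 - y)"
    using S[of 2] h q2 by (simp add: power2_eq_square algebra_simps)
  have q4: "cofactor $ 4 = cofactor $ 3 * y" using S[of 3] h by simp
  have q5: "cofactor $ 5 = cofactor $ 3 * y\<^sup>2 - 1/60" using S[of 4] h q4 by (simp add: power2_eq_square)
  have b1: "\<bar>cofactor $ 1\<bar> \<le> 2475/10000" using y unfolding q1 by simp
  have b2: "\<bar>cofactor $ 2\<bar> \<le> 1864/10000"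
  proof -
    have "(1 - y) * y \<le> 2475/10000 * (7527/10000)" by (rule mult_mono) (use y in auto)
    moreover have "0 \<le> (1 - y) * y" using y by simp
    ultimately show ?thesis unfolding q2 by (simp add: algebra_simps abs_le_iff)
  qed
  have b3: "264/10000 \<le> cofactor $ 3" "cofactor $ 3 \<le> 267/10000"
  proof -
    have "y\<^sup>2 * (1 - y) \<le> (7527/10000)\<^sup>2 * (2475/10000)" by (rule mult_mono) (use y y2 in auto)
    moreover have "(7525/10000)\<^sup>2 * (2473/10000) \<le> y\<^sup>2 * (1 - y)" by (rule mult_mono) (use y y2 in auto)
    ultimately show "264/10000 \<le> cofactor $ 3" "cofactor $ 3 \<le> 267/10000"
      unfolding q3 by (simp_all add: power2_eq_square)
  qed
  have b4: "\<bar>cofactor $ 4\<bar> \<le> 201/10000"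
  proof -
    have "cofactor $ 3 * y \<le> 267/10000 * (7527/10000)" by (rule mult_mono) (use y b3 in auto)
    moreover have "0 \<le> cofactor $ 3 * y" using y b3 by simp
    ultimately show ?thesis unfolding q4 by simp
  qed
  have b5: "\<bar>cofactor $ 5\<bar> \<le> 18/10000"
  proof -
    have "cofactor $ 3 * y\<^sup>2 \<le> 267/10000 * (7527/10000)\<^sup>2" by (rule mult_mono) (use y2 b3 in auto)
    moreover have "264/10000 * (7525/10000)\<^sup>2 \<le> cofactor $ 3 * y\<^sup>2" by (rule mult_mono) (use y2 b3 in auto)
    ultimately show ?thesis unfolding q5 by (simp add: power2_eq_square abs_le_iff)
  qed
  have head: "(\<Sum>k\<in>{1..5}. \<bar>cofactor $ k\<bar> * (7/5) ^ k) \<le> 874/1000"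
  proof -
    have "{1..5::nat} = {1,2,3,4,5}" by auto
    hence "(\<Sum>k\<in>{1..5}. \<bar>cofactor $ k\<bar> * (7/5) ^ k) =
      \<bar>cofactor $ 1\<bar> * (7/5) + \<bar>cofactor $ 2\<bar> * (7/5)^2 + \<bar>cofactor $ 3\<bar> * (7/5)^3
        + \<bar>cofactor $ 4\<bar> * (7/5)^4 + \<bar>cofactor $ 5\<bar> * (7/5)^5" by simp
    thus ?thesis using b1 b2 b3 b4 b5 by (simp add: power_divide)
  qed
  have tail: "(\<Sum>k\<in>{6..<M}. \<bar>cofactor $ k\<bar> * (7/5) ^ k) \<le> 26/1000" for M
  proof -
    have "(\<Sum>k\<in>{6..<M}. \<bar>cofactor $ k\<bar> * (7/5) ^ k) \<le> (\<Sum>k\<in>{6..<M}. 9 * (7/20) ^ k)"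
    proof (rule sum_mono)
      fix k
      have "\<bar>cofactor $ k\<bar> * (7/5) ^ k \<le> 9 / 4 ^ k * (7/5) ^ k"
        by (intro mult_right_mono abs_cofactor_le) simp
      also have "9 / 4 ^ k * x ^ k = 9 * (x / 4) ^ k" for x :: real by (simp add: power_divide)
      finally show "\<bar>cofactor $ k\<bar> * (7/5) ^ k \<le> 9 * (7/20) ^ k" by simp
    qed
    also have "\<dots> = 9 * (7/20) ^ 6 * (\<Sum>j<M - 6. (7/20) ^ j)"
    proof -
      have "(\<Sum>k\<in>{6..<M}. 9 * (7/20 :: real) ^ k) = (\<Sum>j<M - 6. 9 * (7/20) ^ (6 + j))"
        by (rule sum.reindex_bij_witness[of _ "\<lambda>j. 6 + j" "\<lambda>k. k - 6"]) auto
      thus ?thesis by (simp add: power_add sum_distrib_left mult.assoc)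
    qed
    also have "(\<Sum>j<M - 6. (7/20 :: real) ^ j) \<le> (\<Sum>j. (7/20) ^ j)"
      by (rule sum_le_suminf) (auto intro: summable_geometric)
    also have "(\<Sum>j. (7/20 :: real) ^ j) = 20/13" by (subst suminf_geometric) auto
    finally show ?thesis by (simp add: power_divide)
  qed
  have "(\<Sum>k\<in>{1..N}. \<bar>cofactor $ k\<bar> * (7/5) ^ k) \<le> (\<Sum>k\<in>{1..5} \<union> {6..<Suc N}. \<bar>cofactor $ k\<bar> * (7/5) ^ k)"
    by (rule sum_mono2) auto
  also have "\<dots> = (\<Sum>k\<in>{1..5}. \<bar>cofactor $ k\<bar> * (7/5) ^ k) + (\<Sum>k\<in>{6..<Suc N}. \<bar>cofactor $ k\<bar> * (7/5) ^ k)"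
    by (rule sum.union_disjoint) auto
  also have "\<dots> \<le> 874/1000 + 26/1000" by (intro add_mono head tail)
  finally show ?thesis by simp
qed

text \<open>A root in \<open>(0, c)\<close> would be a root of the cofactor, whose values in \<open>(0, 7/5)\<close> differ from \<open>1\<close>
by at most \<open>9/10\<close>.\<close>

lemma smallest: "smallest_pos_root root_fun c"
  unfolding smallest_pos_root_def
proof (intro conjI allI impI c_pos root)
  fix z assume z: "z > 0 \<and> root_fun z = 0"
  show "c \<le> z"
  proof (rule ccontr)
    assume "\<not> c \<le> z"
    hence zc: "z < c" by simp
    hence z14: "z < 7/5" using c_lt by simp
    have zsq: "z\<^sup>2 \<le> 2"
    proof -
      have "z\<^sup>2 \<le> c\<^sup>2" by (rule power_mono) (use z zc in auto)
      thus ?thesis using c_sq_le by linarith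
    qed
    let ?q = "\<lambda>n. cofactor $ n * z ^ n"
    have sm: "summable ?q"
    proof (rule summable_comparison_test'[where g = "\<lambda>n. 9 * (1/2) ^ n" and N = 0])
      fix n
      have "norm (?q n) = \<bar>cofactor $ n\<bar> * z ^ n" using z by (simp add: abs_mult)
      also have "\<dots> \<le> 9 / 4 ^ n * 2 ^ n"
        by (intro mult_mono abs_cofactor_le power_mono) (use z z14 in auto)
      also have "\<dots> = 9 * (2 / 4) ^ n" by (simp only: power_divide times_divide_eq_left times_divide_eq_right)
      finally show "norm (?q n) \<le> 9 * (1/2) ^ n" by simp
    qed (intro summable_mult summable_geometric, simp)
    define s where "s = suminf ?q"
    have qs: "?q sums s" using sm by (simp add: s_def summable_sums)
    have shift: "(\<lambda>n. case n of 0 \<Rightarrow> 0 | Suc m \<Rightarrow> z / c * ?q m) sums (z / c * s)"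
      using sums_Suc[of "\<lambda>n. case n of 0 \<Rightarrow> 0 | Suc m \<Rightarrow> z / c * ?q m"] sums_mult[OF qs, of "z / c"] by simp
    have "(\<lambda>n. ?q n - (case n of 0 \<Rightarrow> 0 | Suc m \<Rightarrow> z / c * ?q m)) sums (s - z / c * s)"
      by (rule sums_diff[OF qs shift])
    also have "(\<lambda>n. ?q n - (case n of 0 \<Rightarrow> 0 | Suc m \<Rightarrow> z / c * ?q m)) = (\<lambda>n. hook_denom $ n * z ^ n)"
    proof
      fix n show "?q n - (case n of 0 \<Rightarrow> 0 | Suc m \<Rightarrow> z / c * ?q m) = hook_denom $ n * z ^ n"
        by (cases n) (simp_all add: cofactor_Suc algebra_simps)
    qed
    finally have "s - z / c * s = root_fun z"
      using root_fun_sums[OF zsq] by (rule sums_unique2)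
    hence "(1 - z / c) * s = 0" using z by (simp add: algebra_simps)
    hence "s = 0" using zc c_pos by simp
    moreover have "1/10 \<le> s"
    proof (rule LIMSEQ_le_const)
      show "(\<lambda>N. \<Sum>n\<le>N. ?q n) \<longlonglongrightarrow> s" using qs by (simp add: sums_def_le)
      have "1/10 \<le> (\<Sum>n\<le>N. ?q n)" for N
      proof -
        have "(\<Sum>n\<le>N. ?q n) = 1 + (\<Sum>n\<in>{1..N}. ?q n)"
          by (simp add: atMost_atLeast0 sum.atLeast_Suc_atMost)
        moreover have "- (\<Sum>n\<in>{1..N}. ?q n) \<le> (\<Sum>n\<in>{1..N}. \<bar>cofactor $ n\<bar> * (7/5) ^ n)"
          unfolding sum_negf[symmetric]
        proof (rule sum_mono)
          fix n
          have "- ?q n \<le> \<bar>cofactor $ n\<bar> * z ^ n"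
            using z by (metis abs_ge_minus_self abs_mult abs_of_pos zero_less_power)
          also have "\<dots> \<le> \<bar>cofactor $ n\<bar> * (7/5) ^ n"
            by (intro mult_left_mono power_mono) (use z z14 in auto)
          finally show "- ?q n \<le> \<bar>cofactor $ n\<bar> * (7/5) ^ n" .
        qed
        ultimately show ?thesis using cofactor_tail_small[of N] by linarith
      qed
      thus "\<exists>N. \<forall>n\<ge>N. 1/10 \<le> (\<Sum>n\<le>n. ?q n)" by blast
    qed
    ultimately show False by simp
  qed
qed

definition log_deriv_cofactor :: "real fps" where
  "log_deriv_cofactor = fps_deriv cofactor * inverse cofactor"

lemma log_deriv_cofactor_mult: "log_deriv_cofactor * cofactor = fps_deriv cofactor"
  using inverse_mult_eq_1[of cofactor] by (simp add: log_deriv_cofactor_def mult.assoc)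

lemma abs_log_deriv_cofactor_le: "\<bar>log_deriv_cofactor $ n\<bar> * (7/5) ^ n \<le> 90"
proof -
  have "\<bar>fps_deriv cofactor $ n\<bar> * (7/5) ^ n \<le> 9" for n
  proof -
    have "\<bar>fps_deriv cofactor $ n\<bar> * (7/5) ^ n = real (Suc n) * \<bar>cofactor $ Suc n\<bar> * (7/5) ^ n"
      by (simp add: abs_mult)
    also have "\<dots> \<le> 2 ^ n * (9 / 4 ^ Suc n) * 2 ^ n"
    proof -
      have "Suc n \<le> 2 ^ n" by (simp add: Suc_leI)
      hence "real (Suc n) \<le> 2 ^ n" by (metis of_nat_le_iff of_nat_numeral of_nat_power)
      thus ?thesis by (intro mult_mono abs_cofactor_le power_mono) auto
    qed
    also have "\<dots> = 9 / 4" by (simp add: power_mult_distrib[symmetric])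
    finally show ?thesis by simp
  qed
  thus ?thesis
    using fps_inverse_coeff_bound[of "7/5" cofactor log_deriv_cofactor "fps_deriv cofactor" "9/10" 9 n]
      log_deriv_cofactor_mult cofactor_tail_small by simp
qed

text \<open>The logarithmic derivative of the factorization: the linear factor contributes the pole
\<open>1 / (c - z)\<close>, a geometric series, and the cofactor contributes the error term.\<close>

lemma log_deriv_hook_denom:
  "(- fps_deriv hook_denom * inverse hook_denom) $ n = (1 / c) ^ Suc n - log_deriv_cofactor $ n"
proof -
  define L where "L = 1 - fps_const (1 / c) * fps_X"
  define G where "G = Abs_fps (\<lambda>n. (1 / c) ^ n)"
  have GL: "G * L = 1"
  proof (rule fps_ext)
    fix n show "(G * L) $ n = 1 $ n"
      by (cases n) (simp_all add: L_def G_def right_diff_distrib mult.left_commute[of _ "fps_const _"])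
  qed
  have M: "hook_denom = L * cofactor" unfolding L_def by (rule hook_denom_factor)
  have "- fps_deriv hook_denom = fps_const (1 / c) * cofactor - L * fps_deriv cofactor"
    unfolding M by (simp add: L_def algebra_simps)
  also have "\<dots> = fps_const (1 / c) * (G * L) * cofactor - L * (log_deriv_cofactor * cofactor)"
    by (simp add: GL log_deriv_cofactor_mult)
  also have "\<dots> = (fps_const (1 / c) * G - log_deriv_cofactor) * hook_denom"
    unfolding M by (simp add: algebra_simps)
  finally have "- fps_deriv hook_denom * inverse hook_denom = fps_const (1 / c) * G - log_deriv_cofactor"
    using hook_denom_inverse by (simp add: mult.assoc)
  thus ?thesis by (simp add: G_def)
qed

text \<open>For \<open>n > 0\<close> the ratio is \<open>1 - c\<^sup>n\<^sup>+\<^sup>1 b\<^sub>n\<close> where \<open>b\<^sub>n = O((5/7)\<^sup>n)\<close> is the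
\<open>n\<close>-th coefficient of \<open>log_deriv_cofactor\<close>, and \<open>c < 7/5\<close>.\<close>

lemma VHC_asymp: "(\<lambda>n. real (card (VHC_S n)) / (fact n / c ^ (n + 1))) \<longlonglongrightarrow> 1"
proof -
  have eq: "real (card (VHC_S n)) / (fact n / c ^ (n + 1)) = 1 - c * (log_deriv_cofactor $ n * c ^ n)"
    if n: "n > 0" for n
  proof -
    have "real (card (VHC_S n)) = real (cut_total 0 {1..n})"
      using card_VHC_S[OF n] by (simp add: cut_total_def)
    also have "\<dots> = fact n * cut_fps 0 $ n"
      using cut_total_eq_fps_coeff[of "{1..n}" 0] n by simp
    also have "cut_fps 0 $ n = (1 + cut_fps 0) $ n" using n by simp
    also have "\<dots> = (1 / c) ^ Suc n - log_deriv_cofactor $ n"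
      unfolding cut_fps_0 by (rule log_deriv_hook_denom)
    finally show ?thesis using c_pos by (simp add: field_simps)
  qed
  have "(\<lambda>n. log_deriv_cofactor $ n * c ^ n) \<longlonglongrightarrow> 0"
  proof (rule Lim_null_comparison)
    have "norm (log_deriv_cofactor $ n * c ^ n) \<le> 90 * (c / (7/5)) ^ n" for n
    proof -
      have "norm (log_deriv_cofactor $ n * c ^ n) = \<bar>log_deriv_cofactor $ n\<bar> * (7/5) ^ n * (c / (7/5)) ^ n"
        using c_pos by (simp add: abs_mult power_divide)
      also have "\<dots> \<le> 90 * (c / (7/5)) ^ n"
        using c_pos by (intro mult_right_mono abs_log_deriv_cofactor_le) auto
      finally show ?thesis .
    qed
    thus "eventually (\<lambda>n. norm (log_deriv_cofactor $ n * c ^ n) \<le> 90 * (c / (7/5)) ^ n) sequentially"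
      by simp
    have "(\<lambda>n. (c / (7/5)) ^ n) \<longlonglongrightarrow> 0"
      by (rule LIMSEQ_realpow_zero) (use c_pos c_lt in auto)
    thus "(\<lambda>n. 90 * (c / (7/5)) ^ n) \<longlonglongrightarrow> 0" by (rule tendsto_mult_right_zero)
  qed
  hence "(\<lambda>n. 1 - c * (log_deriv_cofactor $ n * c ^ n)) \<longlonglongrightarrow> 1 - c * 0"
    by (intro tendsto_intros)
  moreover have "eventually (\<lambda>n. 1 - c * (log_deriv_cofactor $ n * c ^ n) =
      real (card (VHC_S n)) / (fact n / c ^ (n + 1))) sequentially"
    using eventually_gt_at_top[of 0] by eventually_elim (simp only: eq)
  ultimately show ?thesis by (simp add: tendsto_cong)
qed

end

theorem corollary7p4:
  shows "\<exists>c::real.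
    smallest_pos_root (\<lambda>z. 1 - z * hypergeo_1F2 (1/2) (3/2) 2 (- (z\<^sup>2))) c \<and>
    \<bar>c - 1.32874\<bar> < 0.000005 \<and>
    asymp_equiv (\<lambda>n. real (card (VHC_S n))) sequentially (\<lambda>n. fact n / c ^ (n + 1))"
proof -
  obtain c where c: "1328735/1000000 < c" "c < 1328745/1000000" "root_fun c = 0"
    using root_fun_root_exists by blast
  interpret root_fun_root c by unfold_locales (rule c)+
  have "root_fun = (\<lambda>z. 1 - z * hypergeo_1F2 (1/2) (3/2) 2 (- (z\<^sup>2)))"
    by (rule ext) (rule root_fun_def)
  hence "smallest_pos_root (\<lambda>z. 1 - z * hypergeo_1F2 (1/2) (3/2) 2 (- (z\<^sup>2))) c"
    using smallest by simp
  moreover have "\<bar>c - 1.32874\<bar> < 0.000005" unfolding abs_less_iff using c(1,2) by simp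
  moreover have "asymp_equiv (\<lambda>n. real (card (VHC_S n))) sequentially (\<lambda>n. fact n / c ^ (n + 1))"
    by (rule asymp_equivI'[OF VHC_asymp])
  ultimately show ?thesis by blast
qed

end
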